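(* Let $R$ be an integral domain and $A$ a symmetric cellular $R$-algebra with cell datum $(\Lambda,M,C,i)$ and cellular basis $\{C_{S,T}^{\lambda}\mid S,T\in M(\lambda),\lambda\in\Lambda\}$. Let $\tau$ be a symmetrizing trace on $A$ and $\{D_{T,S}^{\lambda}\mid S,T\in M(\lambda),\lambda\in\Lambda\}$ the dual basis of the cellular basis with respect to $\tau$. Let $I$ be the ideal $I=I^{\Lambda}+I_D^{\Lambda}$ defined in the context. Then: (1) $I\subseteq \operatorname{rad}A$ and $I^{3}=0$. (2) $I$ is independent of the choice of $\tau$. Moreover, if $R$ is a field, then: (3) $\dim_{R}I\geq\sum_{\lambda\in\Lambda_{2}}(n_{\lambda}+\dim_{R}\operatorname{rad}\lambda)\dim_{R}L_{\lambda}+\sum_{\lambda\in\Lambda_{4}}n_{\lambda}^{2}$, where $n_{\lambda}$ is the number of elements of $M(\lambda)$. (4) $\sum_{\lambda\in\Lambda_{2}}(\dim_{R}L_{\lambda})^{2}-\sum_{\lambda\in\Lambda_{3}}n_{\lambda}^{2}\leq\sum_{\lambda\in\Lambda_{2}}(\dim_{R}\operatorname{rad}\lambda)^{2}-\sum_{\lambda\in\Lambda_{4}}n_{\lambda}^{2}$.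
   Context: Cellular algebra (Goodman's version). An associative unital $R$-algebra $A$ is cellular with cell datum $(\Lambda, M, C, i)$ if: (C1) $\Lambda$ is a finite poset; to each $\lambda\in\Lambda$ is attached a finite (nonempty) set $M(\lambda)$; $A$ has an $R$-basis $\{C_{S,T}^{\lambda}\mid S,T\in M(\lambda),\lambda\in\Lambda\}$ (a cellular basis). (C2) $i$ is an $R$-linear anti-automorphism of $A$ with $i^2=\mathrm{id}$ and $i(C_{S,T}^{\lambda})\equiv C_{T,S}^{\lambda} \pmod{A(<\lambda)}$, where $A(<\lambda)$ is the $R$-submodule generated by $\{C_{S'',T''}^{\mu}\mid S'',T''\in M(\mu),\mu<\lambda\}$. (C3) For $a\in A$, $aC_{S,T}^{\lambda}\equiv\sum_{S'\in M(\lambda)}r_a(S',S)C_{S',T}^{\lambda}\pmod{A(<\lambda)}$, where $r_a(S',S)\in R$ is independent of $T$. Symmetric algebra. An $R$-algebra $A$, finitely generated and free as an $R$-module, is symmetric if it carries a non-degenerate associative symmetric $R$-bilinear form $f$ (non-degenerate: the determinant of $(f(a_i,a_j))$ is a unit of $R$ for some $R$-basis $(a_i)$; associative: $f(ab,c)=f(a,bc)$). The map $\tau(a)=f(a,1)$ is called a symmetrizing trace. A symmetric cellular algebra is both symmetric and cellular. Dual basis. $\{D_{S,T}^{\lambda}\}$ is the basis with $\tau(C_{S,T}^{\lambda}D_{U,V}^{\mu})=\delta_{\lambda\mu}\delta_{SV}\delta_{TU}$. It is again a cellular basis for the opposite order on $\Lambda$. Forms. For $S,T,U,V\in M(\lambda)$,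 elements $\Phi(T,U),\Psi(T,U)\in R$, depending only on $T,U$, are defined by $C_{S,T}^{\lambda}C_{U,V}^{\lambda}\equiv\Phi(T,U)C_{S,V}^{\lambda}\pmod{A(<\lambda)}$ and $D_{S,T}^{\lambda}D_{U,V}^{\lambda}\equiv\Psi(T,U)D_{S,V}^{\lambda}\pmod{A_D(>\lambda)}$, where $A_D(>\lambda)$ is the $R$-span of all $D_{X,Y}^{\mu}$ with $\mu>\lambda$. Define $k_\lambda=k_{\lambda,\tau}=\sum_{X\in M(\lambda)}\Phi(X,V)\Psi(X,V)$ for an arbitrary $V\in M(\lambda)$; this does not depend on $V$. Cell modules. $W(\lambda)$ is the left $A$-module, free over $R$ with basis $\{C_S\mid S\in M(\lambda)\}$, with $aC_S=\sum_{S'\in M(\lambda)}r_a(S',S)C_{S'}$. The bilinear form $\Phi_\lambda$ on $W(\lambda)$ is $\Phi_\lambda(C_S,C_T)=\Phi(S,T)$ (it is symmetric); $\operatorname{rad}\lambda=\{x\in W(\lambda)\mid\Phi_\lambda(x,y)=0\text{ for all }y\in W(\lambda)\}$; $L_\lambda=W(\lambda)/\operatorname{rad}\lambda$. Ideals. For $\lambda\in\Lambda$, the elements $C_{S,V}^{\lambda}D_{V,U}^{\lambda}$ and $D_{U,V}^{\lambda}C_{V,S}^{\lambda}$ do not depend on $V\in M(\lambda)$. Let $I^{\lambda}$ be the set of elements $\sum_{S,U\in M(\lambda)}r_{SU}C_{S,V}^{\lambda}D_{V,U}^{\lambda}$ with $r_{SU}\in R$, and $I_D^{\lambda}$ the set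 of elements $\sum_{S,U\in M(\lambda)}r_{US}D_{U,V}^{\lambda}C_{V,S}^{\lambda}$ with $r_{US}\in R$; these are ideals of $A$. Put $I^{\Lambda}=\sum_{\lambda\in\Lambda,\,k_\lambda=0}I^{\lambda}$, $I_D^{\Lambda}=\sum_{\lambda\in\Lambda,\,k_\lambda=0}I_D^{\lambda}$, and $I=I^{\Lambda}+I_D^{\Lambda}$. Index sets. $\Lambda_0=\{\lambda\in\Lambda\mid\Phi_\lambda\neq0\}$, $\Lambda_1=\{\lambda\in\Lambda\mid\operatorname{rad}\lambda=0\}$, $\Lambda_2=\Lambda_0-\Lambda_1$, $\Lambda_3=\Lambda-\Lambda_0$, $\Lambda_4=\{\lambda\in\Lambda_1\mid k_\lambda=0\}$. $\operatorname{rad}A$ denotes the (Jacobson) radical of $A$. *)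

theory Defs
  imports
    "Jordan_Normal_Form.Determinant"
    "HOL-Library.Set_Algebras"
    "HOL-Library.Function_Algebras"
begin

text \<open>
  Modules are those of \<^theory>\<open>HOL.Modules\<close>, written qualified because
  HOL-Algebra has a locale of the same base name.
\<close>

section \<open>Dimensions\<close>

text \<open>
  The body of \<^const>\<open>vector_space.dim\<close>, at a type of scalars that need not be of class
  \<^class>\<open>field\<close>, so that it can be used for an integral domain that happens to be a field.
\<close>

definition dim_over :: "('r::comm_ring_1 \<Rightarrow> 'v::ab_group_add \<Rightarrow> 'v) \<Rightarrow> 'v set \<Rightarrow> nat" where
  "dim_over scale V =
    (if \<exists>B. \<not> Modules.module.dependent scale B \<and> Modules.module.span scale B = Modules.module.span scale V
     then card (SOME B. \<not> Modules.module.dependent scale B \<and>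
                        Modules.module.span scale B = Modules.module.span scale V)
     else 0)"

lemma dim_over_eq_dim:
  assumes "vector_space scale"
  shows "dim_over scale V = vector_space.dim scale V"
  unfolding dim_over_def vector_space.dim_def[OF assms] by simp

text \<open>
  The elements of the quotient module of \<open>V\<close> by a submodule \<open>U\<close> are the cosets \<open>x +o U\<close>.
  The linear combination \<open>\<Sum>X\<in>B. c X \<cdot> X\<close> of cosets in the quotient module is computed
  with Minkowski sums: the summand \<open>U\<close> absorbs that \<open>0 \<cdot> X\<close> is \<open>{0}\<close> as a set image and
  that the empty Minkowski sum is \<open>{0}\<close>, while the zero of the quotient is \<open>U\<close>.
\<close>

definition quotient_module :: "'v::ab_group_add set \<Rightarrow> 'v set \<Rightarrow> 'v set set" where
  "quotient_module V U = (\<lambda>x. x +o U) ` V"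

definition quotient_basis ::
    "('r::comm_ring_1 \<Rightarrow> 'v::ab_group_add \<Rightarrow> 'v) \<Rightarrow> 'v set \<Rightarrow> 'v set \<Rightarrow> 'v set set \<Rightarrow> bool" where
  "quotient_basis scale V U B \<longleftrightarrow>
     finite B \<and> B \<subseteq> quotient_module V U \<and>
     (\<forall>X \<in> quotient_module V U.
        \<exists>!c. (\<forall>Y. Y \<notin> B \<longrightarrow> c Y = 0) \<and> X = (\<Sum>Y\<in>B. scale (c Y) ` Y) + U)"

definition quotient_dim ::
    "('r::comm_ring_1 \<Rightarrow> 'v::ab_group_add \<Rightarrow> 'v) \<Rightarrow> 'v set \<Rightarrow> 'v set \<Rightarrow> nat" where
  "quotient_dim scale V U = (THE n. \<exists>B. quotient_basis scale V U B \<and> card B = n)"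


section \<open>The Jacobson radical\<close>

definition left_ideal :: "'a::ring set \<Rightarrow> bool" where
  "left_ideal J \<longleftrightarrow> 0 \<in> J \<and> (\<forall>x\<in>J. \<forall>y\<in>J. x - y \<in> J) \<and> (\<forall>a. \<forall>x\<in>J. a * x \<in> J)"

definition maximal_left_ideal :: "'a::ring set \<Rightarrow> bool" where
  "maximal_left_ideal J \<longleftrightarrow>
     left_ideal J \<and> J \<noteq> UNIV \<and> (\<forall>K. left_ideal K \<and> J \<subseteq> K \<and> K \<noteq> UNIV \<longrightarrow> K = J)"

definition jacobson_radical :: "'a::ring set" where
  "jacobson_radical = \<Inter>{J. maximal_left_ideal J}"


section \<open>Algebras and symmetrizing traces\<close>

text \<open>
  The sort \<open>{ring, monoid_mult}\<close> is that of unital rings, the zero ring included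
  (\<^class>\<open>ring_1\<close> would exclude it).
\<close>

locale unital_algebra = Modules.module scale
  for scale :: "'r::idom \<Rightarrow> 'a::{ring, monoid_mult} \<Rightarrow> 'a" (infixr \<open>*s\<close> 75) +
  assumes scale_mult_left: "(r *s a) * b = r *s (a * b)"
    and scale_mult_right: "a * (r *s b) = r *s (a * b)"
begin

definition basis_family :: "('k \<Rightarrow> 'a) \<Rightarrow> 'k set \<Rightarrow> bool" where
  "basis_family b K \<longleftrightarrow> inj_on b K \<and> independent (b ` K) \<and> span (b ` K) = UNIV"

definition symmetrizing_form :: "('a \<Rightarrow> 'a \<Rightarrow> 'r) \<Rightarrow> bool" where
  "symmetrizing_form f \<longleftrightarrow>
     (\<forall>b. module_hom scale (*) (\<lambda>a. f a b)) \<and> (\<forall>a. module_hom scale (*) (\<lambda>b. f a b)) \<and>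
     (\<forall>a b. f a b = f b a) \<and>
     (\<forall>a b c. f (a * b) c = f a (b * c)) \<and>
     (\<exists>(n::nat) b. basis_family b {..<n} \<and> det (mat n n (\<lambda>(j, k). f (b j) (b k))) dvd 1)"

definition symmetrizing_trace :: "('a \<Rightarrow> 'r) \<Rightarrow> bool" where
  "symmetrizing_trace \<tau> \<longleftrightarrow> (\<exists>f. symmetrizing_form f \<and> \<tau> = (\<lambda>a. f a 1))"

definition set_prod :: "'a set \<Rightarrow> 'a set \<Rightarrow> 'a set" where
  "set_prod X Y = span {x * y | x y. x \<in> X \<and> y \<in> Y}"

end


section \<open>Cellular algebras\<close>

text \<open>The index \<open>l\<close> stands for the \<open>\<lambda>\<close> of the literature.\<close>

definition cell_index :: "'l set \<Rightarrow> ('l \<Rightarrow> 'm set) \<Rightarrow> ('l \<times> 'm \<times> 'm) set" where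
  "cell_index \<Lambda> M = {(l, S, T). l \<in> \<Lambda> \<and> S \<in> M l \<and> T \<in> M l}"

locale cell_family = unital_algebra scale
  for scale :: "'r::idom \<Rightarrow> 'a::{ring, monoid_mult} \<Rightarrow> 'a" (infixr \<open>*s\<close> 75) +
  fixes \<Lambda> :: "'l::order set"
    and M :: "'l \<Rightarrow> 'm set"
    and C :: "'l \<Rightarrow> 'm \<Rightarrow> 'm \<Rightarrow> 'a"
begin

definition lower :: "'l \<Rightarrow> 'a set" where
  "lower l = span {C m S T | m S T. m \<in> \<Lambda> \<and> m < l \<and> S \<in> M m \<and> T \<in> M m}"

end

locale cellular_algebra = cell_family scale \<Lambda> M C
  for scale :: "'r::idom \<Rightarrow> 'a::{ring, monoid_mult} \<Rightarrow> 'a" (infixr \<open>*s\<close> 75)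
    and \<Lambda> :: "'l::order set"
    and M :: "'l \<Rightarrow> 'm set"
    and C :: "'l \<Rightarrow> 'm \<Rightarrow> 'm \<Rightarrow> 'a" +
  fixes i :: "'a \<Rightarrow> 'a"
  assumes finite_poset: "finite \<Lambda>"
    and finite_M: "l \<in> \<Lambda> \<Longrightarrow> finite (M l)"
    and M_nonempty: "l \<in> \<Lambda> \<Longrightarrow> M l \<noteq> {}"
    and C_basis: "basis_family (\<lambda>(l, S, T). C l S T) (cell_index \<Lambda> M)"
    and i_linear: "module_hom scale scale i"
    and i_anti: "i (a * b) = i b * i a"
    and i_invol: "i (i a) = a"
    and i_C: "\<lbrakk>l \<in> \<Lambda>; S \<in> M l; T \<in> M l\<rbrakk> \<Longrightarrow> i (C l S T) - C l T S \<in> lower l"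
    and mult_C: "l \<in> \<Lambda> \<Longrightarrow>
      \<exists>r. \<forall>S\<in>M l. \<forall>T\<in>M l. a * C l S T - (\<Sum>S'\<in>M l. r S' S *s C l S' T) \<in> lower l"
begin

definition dual_basis :: "('a \<Rightarrow> 'r) \<Rightarrow> ('l \<Rightarrow> 'm \<Rightarrow> 'm \<Rightarrow> 'a) \<Rightarrow> bool" where
  "dual_basis \<tau> D \<longleftrightarrow>
     basis_family (\<lambda>(l, S, T). D l S T) (cell_index \<Lambda> M) \<and>
     (\<forall>(l, S, T) \<in> cell_index \<Lambda> M. \<forall>(m, U, V) \<in> cell_index \<Lambda> M.
        \<tau> (C l S T * D m U V) = (if l = m \<and> S = V \<and> T = U then 1 else 0))"

definition upper :: "('l \<Rightarrow> 'm \<Rightarrow> 'm \<Rightarrow> 'a) \<Rightarrow> 'l \<Rightarrow> 'a set" where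
  "upper D l = span {D m S T | m S T. m \<in> \<Lambda> \<and> l < m \<and> S \<in> M m \<and> T \<in> M m}"

definition \<Phi> :: "'l \<Rightarrow> 'm \<Rightarrow> 'm \<Rightarrow> 'r" where
  "\<Phi> l T U = (THE r. \<forall>S\<in>M l. \<forall>V\<in>M l. C l S T * C l U V - r *s C l S V \<in> lower l)"

definition \<Psi> :: "('l \<Rightarrow> 'm \<Rightarrow> 'm \<Rightarrow> 'a) \<Rightarrow> 'l \<Rightarrow> 'm \<Rightarrow> 'm \<Rightarrow> 'r" where
  "\<Psi> D l T U = (THE r. \<forall>S\<in>M l. \<forall>V\<in>M l. D l S T * D l U V - r *s D l S V \<in> upper D l)"

text \<open>An arbitrary element of \<open>M l\<close>; nothing below depends on the choice.\<close>

definition pick :: "'l \<Rightarrow> 'm" where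
  "pick l = (SOME V. V \<in> M l)"

definition k_const :: "('l \<Rightarrow> 'm \<Rightarrow> 'm \<Rightarrow> 'a) \<Rightarrow> 'l \<Rightarrow> 'r" where
  "k_const D l = (\<Sum>X\<in>M l. \<Phi> l X (pick l) * \<Psi> D l X (pick l))"

text \<open>
  The element \<open>\<Sum>S\<in>M l. x S \<cdot> C\<^sub>S\<close> of the cell module is represented by its coordinate
  function \<open>x\<close>, extended by zero outside \<open>M l\<close>. Only the \<open>R\<close>-module structure of the
  cell module is needed.
\<close>

definition W :: "'l \<Rightarrow> ('m \<Rightarrow> 'r) set" where
  "W l = {x. \<forall>S. S \<notin> M l \<longrightarrow> x S = 0}"

definition scaleW :: "'r \<Rightarrow> ('m \<Rightarrow> 'r) \<Rightarrow> 'm \<Rightarrow> 'r" where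
  "scaleW r x = (\<lambda>S. r * x S)"

definition cell_form :: "'l \<Rightarrow> ('m \<Rightarrow> 'r) \<Rightarrow> ('m \<Rightarrow> 'r) \<Rightarrow> 'r" where
  "cell_form l x y = (\<Sum>S\<in>M l. \<Sum>T\<in>M l. x S * y T * \<Phi> l S T)"

definition cell_rad :: "'l \<Rightarrow> ('m \<Rightarrow> 'r) set" where
  "cell_rad l = {x \<in> W l. \<forall>y \<in> W l. cell_form l x y = 0}"

definition dim_rad :: "'l \<Rightarrow> nat" where
  "dim_rad l = dim_over scaleW (cell_rad l)"

definition dim_L :: "'l \<Rightarrow> nat" where
  "dim_L l = quotient_dim scaleW (W l) (cell_rad l)"

definition ideal_C :: "('l \<Rightarrow> 'm \<Rightarrow> 'm \<Rightarrow> 'a) \<Rightarrow> 'l \<Rightarrow> 'a set" where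
  "ideal_C D l =
     range (\<lambda>r. \<Sum>S\<in>M l. \<Sum>U\<in>M l. r S U *s (C l S (pick l) * D l (pick l) U))"

definition ideal_D :: "('l \<Rightarrow> 'm \<Rightarrow> 'm \<Rightarrow> 'a) \<Rightarrow> 'l \<Rightarrow> 'a set" where
  "ideal_D D l =
     range (\<lambda>r. \<Sum>S\<in>M l. \<Sum>U\<in>M l. r U S *s (D l U (pick l) * C l (pick l) S))"

text \<open>Sums of ideals are Minkowski sums of sets.\<close>

definition nil_ideal :: "('l \<Rightarrow> 'm \<Rightarrow> 'm \<Rightarrow> 'a) \<Rightarrow> 'a set" where
  "nil_ideal D =
     (\<Sum>l \<in> {l \<in> \<Lambda>. k_const D l = 0}. ideal_C D l) + (\<Sum>l \<in> {l \<in> \<Lambda>. k_const D l = 0}. ideal_D D l)"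

definition \<Lambda>0 :: "'l set" where
  "\<Lambda>0 = {l \<in> \<Lambda>. \<exists>x \<in> W l. \<exists>y \<in> W l. cell_form l x y \<noteq> 0}"

definition \<Lambda>1 :: "'l set" where
  "\<Lambda>1 = {l \<in> \<Lambda>. cell_rad l = {0}}"

definition \<Lambda>2 :: "'l set" where
  "\<Lambda>2 = \<Lambda>0 - \<Lambda>1"

definition \<Lambda>3 :: "'l set" where
  "\<Lambda>3 = \<Lambda> - \<Lambda>0"

definition \<Lambda>4 :: "('l \<Rightarrow> 'm \<Rightarrow> 'm \<Rightarrow> 'a) \<Rightarrow> 'l set" where
  "\<Lambda>4 D = {l \<in> \<Lambda>1. k_const D l = 0}"

end

end

(*
  Write E_SV = C_SX D_XV and F_UT = D_UX C_XT within a cell. Pairing with the trace gives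
  tau(a E_SV) = r_a(V,S) and tau(a F_UT) = r_{i(a)}(U,T), so these elements represent the matrix
  coefficients of the cell modules. As D^l C^m and C^m D^l vanish unless l <= m, elements E of
  different cells annihilate each other, and within a cell E_ST E_UV = k delta_TU E_SV; the same
  holds for F. Hence the sums of the I^l, and of the I_D^l, over the cells with k_l = 0 are
  ideals of square zero, and I^3 = 0. Another symmetrizing trace multiplies every E and F by one
  common element on the right, which gives the independence of the trace.

  Over a field, pair I^l + I_D^l with the span of the C^l. In a basis of W(l) adapted to rad l the
  rank is n^2 - (dim rad)^2, and the pairing is triangular with respect to the order on the cells,
  so these ranks add up to a lower bound for dim I. The forms Phi(x, a y) on the cell modules kill
  I, as r_a = 0 for a in I^Lambda and r_{i(a)} = 0 for a in I_D^Lambda; they have rank (dim L)^2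
  on the span of the C^l and are again triangular, so the codimension of I is at least the sum of
  the (dim L_l)^2. The two bounds together give the last inequality.
*)

theory Submission
  imports Defs "HOL-Computational_Algebra.Polynomial_Factorial"
begin

section \<open>Modules over an integral domain all of whose nonzero elements are units\<close>

text \<open>The trace decides equality (\<open>trace_eqI\<close>) and membership in A(<l)
  (\<open>lower_iff\<close>), so product identities and congruences modulo lower cells alike become
  equations between the matrix coefficients \<open>\<rho>\<close>. The cell axioms control left
  multiplication only; right multiplication is reached through the anti-involution, which is why the
  coefficients of F involve \<open>i a\<close>.

  The constant k has the following origin. On their own cell module, C acts by a matrix with a
  single row, with entries from \<open>\<Phi>\<close>, and D by one with a single column, with
  entries from \<open>\<Psi>\<close>. A product C D depends on its inner indices only through their
  equality, which forces the matrices of \<open>\<Phi>\<close> and \<open>\<Psi>\<close> to multiply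
  to k times the identity. Hence a nonzero k makes the cell form nondegenerate, and the cells with k
  = 0 are exactly those of \<open>\<Lambda>2\<close>, \<open>\<Lambda>3\<close> and
  \<open>\<Lambda>4 D\<close>. This is what brings these index sets into the dimension formulas.

  Both estimates exhibit families of vectors together with test functionals whose matrix is
  unitriangular along the order on the cells.\<close>

definition of_fract :: "'r::idom fract \<Rightarrow> 'r" where
  "of_fract = inv_into UNIV to_fract"

lemma of_fract_to_fract [simp]: "of_fract (to_fract r) = r"
  unfolding of_fract_def by (rule inv_f_f) (simp add: inj_on_def)

locale module_over_field = Modules.module scale
  for scale :: "'r::idom \<Rightarrow> 'v::ab_group_add \<Rightarrow> 'v" (infixr \<open>*s\<close> 75) +
  assumes nonzero_unit: "x \<noteq> 0 \<Longrightarrow> (x::'r) dvd 1"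
begin

text \<open>The inverse \<open>c\<close> of the denominator already lies in the ring, so the
  fraction a/b is the image of \<open>a * c\<close> and the embedding into the fraction field is
  onto.\<close>

lemma to_fract_of_fract [simp]: "to_fract (of_fract q) = (q :: 'r fract)"
proof -
  obtain a b where q: "q = Fract a b" and b: "b \<noteq> 0"
    by (cases q)
  from nonzero_unit[OF b] obtain c where c: "1 = b * c"
    by (rule dvdE)
  have "a = a * c * b" using c by (simp add: ac_simps)
  then have "q = to_fract (a * c)"
    using q b by (simp add: to_fract_def eq_fract)
  then show ?thesis by (simp only: of_fract_to_fract)
qed

text \<open>
  The theory of dimensions needs scalars of class \<^class>\<open>field\<close>. Here \<open>to_fract\<close> is bijective,
  and viewing the module over the fraction field changes neither spans nor independence.
\<close>

definition fract_scale :: "'r fract \<Rightarrow> 'v \<Rightarrow> 'v" where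
  "fract_scale q v = of_fract q *s v"

lemma fract_scale_to_fract [simp]: "fract_scale (to_fract r) v = r *s v"
  by (simp add: fract_scale_def)

lemma all_fract: "(\<forall>q. P q) \<longleftrightarrow> (\<forall>r::'r. P (to_fract r))"
  by (metis to_fract_of_fract)

lemma vector_space_fract_scale: "vector_space fract_scale"
proof -
  show ?thesis
    unfolding vector_space_def
    by (auto simp: all_fract algebra_simps simp flip: to_fract_add to_fract_mult to_fract_1)
qed

lemma subspace_fract_scale: "Modules.module.subspace fract_scale = subspace"
proof -
  interpret vs: vector_space fract_scale by (rule vector_space_fract_scale)
  show ?thesis
    by (auto simp: fun_eq_iff vs.subspace_def subspace_def all_fract)
qed

lemma span_fract_scale: "Modules.module.span fract_scale = span"
proof -
  interpret vs: vector_space fract_scale by (rule vector_space_fract_scale)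
  show ?thesis
    by (simp add: fun_eq_iff vs.span_def span_def subspace_fract_scale)
qed

lemma dependent_fract_scale: "Modules.module.dependent fract_scale = dependent"
proof -
  interpret vs: vector_space fract_scale by (rule vector_space_fract_scale)
  have "vs.dependent S \<longleftrightarrow> dependent S" for S
  proof
    assume "vs.dependent S"
    then obtain t u v where "finite t" "t \<subseteq> S" "(\<Sum>v\<in>t. fract_scale (u v) v) = 0" "v \<in> t" "u v \<noteq> 0"
      unfolding vs.dependent_explicit by blast
    moreover have "of_fract (u v) \<noteq> 0"
      using \<open>u v \<noteq> 0\<close> by (metis to_fract_of_fract to_fract_0)
    ultimately show "dependent S"
      unfolding dependent_explicit fract_scale_def
      by (intro exI[of _ t] exI[of _ "\<lambda>v. of_fract (u v)"]) auto
  next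
    assume "dependent S"
    then obtain t u v where "finite t" "t \<subseteq> S" "(\<Sum>v\<in>t. u v *s v) = 0" "v \<in> t" "u v \<noteq> 0"
      unfolding dependent_explicit by blast
    then show "vs.dependent S"
      unfolding vs.dependent_explicit
      by (intro exI[of _ t] exI[of _ "\<lambda>v. to_fract (u v)"]) auto
  qed
  then show ?thesis by auto
qed

lemma dim_fract_scale: "vector_space.dim fract_scale = dim_over scale"
proof -
  interpret vs: vector_space fract_scale by (rule vector_space_fract_scale)
  show ?thesis
    unfolding fun_eq_iff vs.dim_def dim_over_def dependent_fract_scale span_fract_scale by blast
qed

text \<open>The rewrites let library facts about \<open>vs\<close> speak of the original
  \<open>span\<close>, \<open>dependent\<close> and \<open>dim_over\<close>; from here on the
  fraction field stays out of sight.\<close>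

sublocale vs: vector_space fract_scale
  rewrites "vs.subspace = subspace" and "vs.span = span" and "vs.dependent = dependent"
    and "vs.dim = dim_over scale"
  by (rule vector_space_fract_scale subspace_fract_scale span_fract_scale
      dependent_fract_scale dim_fract_scale)+

section \<open>Independent families and dimension counts\<close>

lemma independent_family:
  assumes K: "finite K" and ind: "\<And>c. (\<Sum>k\<in>K. c k *s x k) = 0 \<Longrightarrow> \<forall>k\<in>K. c k = 0"
  shows "inj_on x K" "independent (x ` K)"
proof -
  show inj: "inj_on x K"
  proof (rule inj_onI, rule ccontr)
    fix k k' assume k: "k \<in> K" "k' \<in> K" "x k = x k'" "k \<noteq> k'"
    \<comment> \<open>Equal values at \<open>k\<close> and \<open>k'\<close> would give this
      nontrivial relation.\<close>
    let ?c = "\<lambda>j. if j = k then 1 else if j = k' then - 1 else (0::'r)"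
    have "(\<Sum>j\<in>K. ?c j *s x j) = (\<Sum>j\<in>{k, k'}. ?c j *s x j)"
      by (rule sum.mono_neutral_right) (use K k in auto)
    also have "\<dots> = 0" using k by simp
    finally show False using ind[of ?c] k by auto
  qed
  show "independent (x ` K)"
    unfolding dependent_finite[OF finite_imageI[OF K]]
  proof (rule notI, elim exE conjE)
    fix u assume u: "\<exists>v\<in>x ` K. u v \<noteq> 0" "(\<Sum>v\<in>x ` K. u v *s v) = 0"
    then have "(\<Sum>k\<in>K. u (x k) *s x k) = 0"
      using sum.reindex[OF inj, where g = "\<lambda>v. u v *s v"] by (simp add: o_def)
    from ind[OF this] u(1) show False by auto
  qed
qed

text \<open>A lower bound for the codimension of \<open>I\<close>: vectors that are independent
  modulo \<open>I\<close> stay independent when a basis of \<open>I\<close> is adjoined.\<close>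

lemma card_add_dim_le:
  assumes fin: "finite B" and I: "subspace I" "I \<subseteq> span B" and K: "finite K"
    and xB: "\<And>k. k \<in> K \<Longrightarrow> x k \<in> span B"
    and ind: "\<And>c. (\<Sum>k\<in>K. c k *s x k) \<in> I \<Longrightarrow> \<forall>k\<in>K. c k = 0"
  shows "card K + dim_over scale I \<le> card B"
proof -
  obtain BI where BI: "BI \<subseteq> I" "independent BI" "I \<subseteq> span BI"
    using vs.maximal_independent_subset[of I] by blast
  have finBI: "finite BI" 
    using vs.independent_span_bound[OF fin BI(2)] BI(1) I(2) by auto
  have ind0: "\<forall>k\<in>K. c k = 0" if "(\<Sum>k\<in>K. c k *s x k) = 0" for c
    using ind that subspace_0[OF I(1)] by auto
  note xK = independent_family[OF K ind0]
  have disj: "x ` K \<inter> BI = {}"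
  proof (rule ccontr)
    assume "x ` K \<inter> BI \<noteq> {}"
    then obtain k where k: "k \<in> K" "x k \<in> I" using BI by auto
    have "(\<Sum>j\<in>K. (if j = k then 1 else 0) *s x j) = (\<Sum>j\<in>K. if j = k then x j else 0)"
      by (rule sum.cong) auto
    also have "\<dots> = x k" using K k by simp
    finally show False using ind[of "\<lambda>j. if j = k then 1 else 0"] k by auto
  qed
  have "independent (x ` K \<union> BI)"
    unfolding dependent_finite[OF finite_UnI[OF finite_imageI[OF K] finBI]]
  proof (rule notI, elim exE conjE)
    fix u assume u: "\<exists>v\<in>x ` K \<union> BI. u v \<noteq> 0" "(\<Sum>v\<in>x ` K \<union> BI. u v *s v) = 0"
    have s: "(\<Sum>v\<in>x ` K. u v *s v) + (\<Sum>v\<in>BI. u v *s v) = 0"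
      using u(2) sum.union_disjoint[OF finite_imageI[OF K] finBI disj] by metis
    moreover have "(\<Sum>v\<in>BI. u v *s v) \<in> I"
      using BI(1) by (intro subspace_sum[OF I(1)] subspace_scale[OF I(1)]) auto
    ultimately have "(\<Sum>v\<in>x ` K. u v *s v) \<in> I"
      by (metis I(1) add_eq_0_iff2 subspace_neg)
    then have "(\<Sum>k\<in>K. u (x k) *s x k) \<in> I"
      using sum.reindex[OF xK(1), where g = "\<lambda>v. u v *s v"] by (simp add: o_def)
    from ind[OF this] have z: "u v = 0" if "v \<in> x ` K" for v using that by auto
    then have "(\<Sum>v\<in>BI. u v *s v) = 0"
      using s by simp
    then have "u v = 0" if "v \<in> BI" for v
      using independentD[OF BI(2) finBI order_refl _ that] by blast
    with z u(1) show False by auto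
  qed
  then have "card (x ` K \<union> BI) \<le> card B"
    using vs.independent_span_bound[OF fin] xB BI(1) I(2) by blast
  moreover have "card (x ` K \<union> BI) = card K + card BI"
    using card_Un_disjoint[OF finite_imageI[OF K] finBI disj] card_image[OF xK(1)] by simp
  moreover have "card BI = dim_over scale I"
    using vs.basis_card_eq_dim[OF BI(1,3,2)] .
  ultimately show ?thesis by simp
qed

lemma card_le_dim:
  assumes fin: "finite B" "I \<subseteq> span B" and K: "finite K"
    and xI: "\<And>k. k \<in> K \<Longrightarrow> x k \<in> I"
    and ind: "\<And>c. (\<Sum>k\<in>K. c k *s x k) = 0 \<Longrightarrow> \<forall>k\<in>K. c k = 0"
  shows "card K \<le> dim_over scale I"
proof -
  obtain BI where BI: "BI \<subseteq> I" "independent BI" "I \<subseteq> span BI"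
    using vs.maximal_independent_subset[of I] by blast
  have finBI: "finite BI" 
    using vs.independent_span_bound[OF fin(1) BI(2)] BI(1) fin(2) by auto
  note xK = independent_family[OF K ind]
  have "x ` K \<subseteq> span BI" using xI BI(3) by auto
  then have "card (x ` K) \<le> card BI"
    using vs.independent_span_bound[OF finBI xK(2)] by blast
  then show ?thesis
    using vs.basis_card_eq_dim[OF BI(1,3,2)] card_image[OF xK(1)] by simp
qed

section \<open>Quotient modules and their dimension\<close>

lemma coset_eq_iff:
  assumes "subspace U"
  shows "x +o U = y +o U \<longleftrightarrow> x - y \<in> U"
proof
  assume "x +o U = y +o U"
  then have "x \<in> y +o U"
    using subspace_0[OF assms] by (metis add.right_neutral set_plus_intro2)
  then show "x - y \<in> U" by (auto simp: elt_set_plus_def)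
next
  assume *: "x - y \<in> U"
  show "x +o U = y +o U"
  proof (rule Set.set_eqI, rule iffI)
    fix z assume "z \<in> x +o U"
    then obtain u where "u \<in> U" "z = x + u" by (auto simp: elt_set_plus_def)
    then have "z = y + ((x - y) + u)" "(x - y) + u \<in> U"
      using subspace_add[OF assms *] by (auto simp: algebra_simps)
    then show "z \<in> y +o U" by (metis set_plus_intro2)
  next
    fix z assume "z \<in> y +o U"
    then obtain u where "u \<in> U" "z = y + u" by (auto simp: elt_set_plus_def)
    then have "z = x + (u - (x - y))" "u - (x - y) \<in> U"
      using subspace_diff[OF assms _ *] by (auto simp: algebra_simps)
    then show "z \<in> x +o U" by (metis set_plus_intro2)
  qed
qed

text \<open>The summand \<open>y +o U\<close> supplies the full coset: for \<open>r = 0\<close> the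
  image of the first coset shrinks to the single element 0.\<close>

lemma coset_combination:
  assumes U: "subspace U"
  shows "(r *s x + y) +o U = scale r ` (x +o U) + (y +o U)"
proof (rule Set.set_eqI, rule iffI)
  fix z assume "z \<in> (r *s x + y) +o U"
  then obtain u where "u \<in> U" "z = r *s x + y + u" by (auto simp: elt_set_plus_def)
  then have "z = r *s (x + 0) + (y + u)" by simp
  then show "z \<in> scale r ` (x +o U) + (y +o U)"
    using \<open>u \<in> U\<close> subspace_0[OF U]
    by (metis imageI set_plus_intro set_plus_intro2)
next
  fix z assume "z \<in> scale r ` (x +o U) + (y +o U)"
  then obtain u v where uv: "u \<in> U" "v \<in> U" and z: "z = r *s (x + u) + (y + v)"
    by (auto simp: elt_set_plus_def set_plus_def)
  have "z = r *s x + y + (r *s u + v)"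
    by (simp add: z scale_right_distrib ac_simps)
  moreover have "r *s u + v \<in> U"
    using uv U by (intro subspace_add subspace_scale)
  ultimately show "z \<in> (r *s x + y) +o U" by (auto simp: elt_set_plus_def)
qed

lemma sum_cosets:
  assumes U: "subspace U" and "finite B" and "\<And>Y. Y \<in> B \<Longrightarrow> Y = y Y +o U"
  shows "(\<Sum>Y\<in>B. scale (c Y) ` Y) + U = (\<Sum>Y\<in>B. c Y *s y Y) +o U"
  using assms(2,3)
proof (induction B rule: finite_induct)
  case empty
  show ?case by (simp add: elt_set_plus_def set_plus_def set_zero)
next
  case (insert Y B)
  have "(\<Sum>Y\<in>insert Y B. scale (c Y) ` Y) + U = scale (c Y) ` Y + ((\<Sum>Y\<in>B. scale (c Y) ` Y) + U)"
    using insert by (simp add: add.assoc)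
  also have "\<dots> = scale (c Y) ` (y Y +o U) + ((\<Sum>Y\<in>B. c Y *s y Y) +o U)"
    using insert by auto
  also have "\<dots> = (\<Sum>Y\<in>insert Y B. c Y *s y Y) +o U"
    using insert by (simp add: coset_combination[OF U])
  finally show ?case .
qed

text \<open>Choosing representatives \<open>y Y\<close> trades Minkowski combinations of cosets for
  congruences modulo \<open>U\<close> between vectors.\<close>

lemma quotient_basis_iff:
  assumes U: "subspace U" and "finite B" "B \<subseteq> quotient_module V U"
    and y: "\<And>Y. Y \<in> B \<Longrightarrow> Y = y Y +o U"
  shows "quotient_basis scale V U B \<longleftrightarrow>
    (\<forall>x\<in>V. \<exists>!c. (\<forall>Y. Y \<notin> B \<longrightarrow> c Y = 0) \<and> x - (\<Sum>Y\<in>B. c Y *s y Y) \<in> U)"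
  using assms(2,3)
  by (simp add: quotient_basis_def quotient_module_def sum_cosets[OF U assms(2) y] coset_eq_iff[OF U])

text \<open>Two inequalities: the representatives are independent modulo \<open>U\<close>, and
  together with a basis of \<open>U\<close> they span \<open>V\<close>. So all quotient bases have
  the same size, and at most one number satisfies the \<open>THE\<close> in
  \<open>quotient_dim\<close>.\<close>

lemma card_quotient_basis:
  assumes V: "subspace V" and U: "subspace U" "U \<subseteq> V" and fin: "finite F" "V \<subseteq> span F"
    and B: "quotient_basis scale V U B"
  shows "card B + dim_over scale U = dim_over scale V"
proof -
  have finB: "finite B" and BQ: "B \<subseteq> quotient_module V U"
    using B by (auto simp: quotient_basis_def)
  have "\<forall>Y\<in>B. \<exists>y. y \<in> V \<and> Y = y +o U"
    using BQ by (auto simp: quotient_module_def)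
  then obtain y where y: "\<And>Y. Y \<in> B \<Longrightarrow> y Y \<in> V" "\<And>Y. Y \<in> B \<Longrightarrow> Y = y Y +o U"
    by metis
  have uniq: "\<exists>!c. (\<forall>Y. Y \<notin> B \<longrightarrow> c Y = 0) \<and> x - (\<Sum>Y\<in>B. c Y *s y Y) \<in> U" if "x \<in> V" for x
    using B that quotient_basis_iff[OF U(1) finB BQ y(2)] by blast
  obtain BV where BV: "BV \<subseteq> V" "independent BV" "V \<subseteq> span BV"
    using vs.maximal_independent_subset[of V] by blast
  obtain BU where BU: "BU \<subseteq> U" "independent BU" "U \<subseteq> span BU"
    using vs.maximal_independent_subset[of U] by blast
  have finV: "finite BV"
    using vs.independent_span_bound[OF fin(1) BV(2)] BV(1) fin(2) by auto
  have finU: "finite BU"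
    using vs.independent_span_bound[OF fin(1) BU(2)] BU(1) U(2) fin(2) by auto
  have dV: "card BV = dim_over scale V" and dU: "card BU = dim_over scale U"
    using vs.basis_card_eq_dim BV BU by auto
  have "card B + dim_over scale U \<le> card BV"
  proof (rule card_add_dim_le[OF finV U(1) _ finB])
    show "U \<subseteq> span BV" using U(2) BV(3) by auto
    show "y Y \<in> span BV" if "Y \<in> B" for Y using y(1)[OF that] BV(3) by auto
    fix c assume c: "(\<Sum>Y\<in>B. c Y *s y Y) \<in> U"
    \<comment> \<open>Uniqueness concerns functions vanishing outside \<open>B\<close>, so
      \<open>c\<close> is cut off there; \<open>?c\<close> and the zero function then both represent
      the class of 0.\<close>
    let ?c = "\<lambda>Y. if Y \<in> B then c Y else 0"
    let ?P = "\<lambda>c. (\<forall>Y. Y \<notin> B \<longrightarrow> c Y = 0) \<and> 0 - (\<Sum>Y\<in>B. c Y *s y Y) \<in> U"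
    note the_eq = the1_equality[OF uniq[OF subspace_0[OF V]]]
    have "(THE c. ?P c) = ?c"
      by (rule the_eq) (use subspace_neg[OF U(1) c] in simp)
    moreover have "(THE c. ?P c) = (\<lambda>Y. 0)"
      by (rule the_eq) (use subspace_0[OF U(1)] in simp)
    ultimately have "?c = (\<lambda>Y. 0)" by simp
    then show "\<forall>Y\<in>B. c Y = 0" by metis
  qed
  moreover have "dim_over scale V \<le> card (y ` B \<union> BU)"
  proof (rule vs.dim_le_card)
    show "V \<subseteq> span (y ` B \<union> BU)"
    proof
      fix x assume "x \<in> V"
      from ex1_implies_ex[OF uniq[OF this]] obtain c where "x - (\<Sum>Y\<in>B. c Y *s y Y) \<in> U" by blast
      then have "x - (\<Sum>Y\<in>B. c Y *s y Y) \<in> span (y ` B \<union> BU)"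
        using BU(3) span_mono[of BU "y ` B \<union> BU"] by auto
      moreover have "(\<Sum>Y\<in>B. c Y *s y Y) \<in> span (y ` B \<union> BU)"
        by (intro span_sum span_scale span_base) auto
      ultimately show "x \<in> span (y ` B \<union> BU)"
        by (metis diff_add_cancel span_add)
    qed
    show "finite (y ` B \<union> BU)" using finB finU by simp
  qed
  moreover have "card (y ` B \<union> BU) \<le> card B + card BU"
    by (rule order_trans[OF card_Un_le]) (simp add: card_image_le finB)
  ultimately show ?thesis using dV dU by simp
qed

lemma independent_complement:
  assumes "finite N" "finite B" "N \<inter> B = {}" "independent (N \<union> B)"
    and sum: "(\<Sum>v\<in>N. e v *s v) \<in> span B" and v: "v \<in> N"
  shows "e v = 0"
proof -
  obtain u where u: "(\<Sum>v\<in>N. e v *s v) = (\<Sum>v\<in>B. u v *s v)"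
    using sum span_finite[OF assms(2)] by auto
  let ?w = "\<lambda>v. if v \<in> N then e v else - u v"
  have "(\<Sum>v\<in>N \<union> B. ?w v *s v) = (\<Sum>v\<in>N. ?w v *s v) + (\<Sum>v\<in>B. ?w v *s v)"
    using assms by (intro sum.union_disjoint)
  also have "(\<Sum>v\<in>N. ?w v *s v) = (\<Sum>v\<in>N. e v *s v)"
    by (rule sum.cong) auto
  also have "(\<Sum>v\<in>B. ?w v *s v) = (\<Sum>v\<in>B. - (u v *s v))"
    by (rule sum.cong) (use assms(3) in auto)
  finally have "(\<Sum>v\<in>N \<union> B. ?w v *s v) = 0"
    using u by (simp add: sum_negf)
  from independentD[OF assms(4) _ order_refl this, of v] assms(1,2) v show ?thesis by auto
qed

text \<open>The vectors \<open>N\<close> that extend a basis of \<open>U\<close> to one of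
  \<open>V\<close> give the quotient basis. Since that is a set of cosets and not a family, distinct
  vectors of \<open>N\<close> must first be shown to have distinct cosets.\<close>

lemma quotient_basis_exists:
  assumes V: "subspace V" and U: "subspace U" "U \<subseteq> V" and fin: "finite F" "V \<subseteq> span F"
  shows "\<exists>B. quotient_basis scale V U B"
proof -
  obtain BU where BU: "BU \<subseteq> U" "independent BU" "U \<subseteq> span BU"
    using vs.maximal_independent_subset[of U] by blast
  obtain BV where BV: "BU \<subseteq> BV" "BV \<subseteq> V" "independent BV" "V \<subseteq> span BV"
    using vs.maximal_independent_subset_extend[of BU V] BU U(2) by blast
  have finV: "finite BV"
    using vs.independent_span_bound[OF fin(1) BV(3)] BV(2) fin(2) by auto
  have finU: "finite BU" using finV BV(1) finite_subset by auto
  have spanU: "span BU = U"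
    using BU U(1) span_minimal by blast
  define N where "N = BV - BU"
  have N: "finite N" "N \<union> BU = BV" "N \<inter> BU = {}"
    using finV BV(1) by (auto simp: N_def)
  have ind: "e v = 0" if "(\<Sum>v\<in>N. e v *s v) \<in> U" "v \<in> N" for e v
    using independent_complement[OF N(1) finU N(3)] N(2) BV(3) that spanU by auto
  have inj: "inj_on (\<lambda>v. v +o U) N"
  proof (rule inj_onI, rule ccontr)
    fix v w assume vw: "v \<in> N" "w \<in> N" "v +o U = w +o U" "v \<noteq> w"
    let ?c = "\<lambda>j. if j = v then 1 else if j = w then - 1 else (0::'r)"
    have "(\<Sum>j\<in>N. ?c j *s j) = (\<Sum>j\<in>{v, w}. ?c j *s j)"
      by (rule sum.mono_neutral_right) (use N vw in auto)
    also have "\<dots> = v - w" using vw by simp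
    also have "\<dots> \<in> U" using coset_eq_iff[OF U(1)] vw by auto
    finally show False using ind[of ?c v] vw by auto
  qed
  define B where "B = (\<lambda>v. v +o U) ` N"
  define y where "y = the_inv_into N (\<lambda>v. v +o U)"
  have finB: "finite B" using N by (simp add: B_def)
  have BQ: "B \<subseteq> quotient_module V U" using N(2) BV(2) by (auto simp: B_def quotient_module_def)
  have yB: "Y = y Y +o U" if "Y \<in> B" for Y
    using f_the_inv_into_f[OF inj] that by (auto simp: B_def y_def)
  have yN: "y (v +o U) = v" if "v \<in> N" for v
    using the_inv_into_f_f[OF inj that] by (simp add: y_def)
  have sum_B: "(\<Sum>Y\<in>B. c Y *s y Y) = (\<Sum>v\<in>N. c (v +o U) *s v)" for c
    unfolding B_def by (subst sum.reindex[OF inj]) (auto intro!: sum.cong simp: yN)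
  have "\<exists>!c. (\<forall>Y. Y \<notin> B \<longrightarrow> c Y = 0) \<and> x - (\<Sum>Y\<in>B. c Y *s y Y) \<in> U" if "x \<in> V" for x
  proof (rule ex_ex1I)
    have "x \<in> span BV" using BV(4) that by auto
    then obtain u where "x = (\<Sum>v\<in>BV. u v *s v)" using span_finite[OF finV] by auto
    then have u: "x = (\<Sum>v\<in>N. u v *s v) + (\<Sum>v\<in>BU. u v *s v)"
      using sum.union_disjoint[OF N(1) finU N(3)] N(2) by metis
    let ?c = "\<lambda>Y. if Y \<in> B then u (y Y) else 0"
    have "(\<Sum>Y\<in>B. ?c Y *s y Y) = (\<Sum>v\<in>N. u v *s v)"
      unfolding sum_B by (rule sum.cong) (auto simp: yN B_def)
    then have "x - (\<Sum>Y\<in>B. ?c Y *s y Y) = (\<Sum>v\<in>BU. u v *s v)"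
      using u by simp
    also have "\<dots> \<in> U"
      using BU(1) by (intro subspace_sum subspace_scale U(1)) auto
    finally show "\<exists>c. (\<forall>Y. Y \<notin> B \<longrightarrow> c Y = 0) \<and> x - (\<Sum>Y\<in>B. c Y *s y Y) \<in> U"
      by (intro exI[of _ ?c]) auto
  next
    fix c d
    assume c: "(\<forall>Y. Y \<notin> B \<longrightarrow> c Y = 0) \<and> x - (\<Sum>Y\<in>B. c Y *s y Y) \<in> U"
      and d: "(\<forall>Y. Y \<notin> B \<longrightarrow> d Y = 0) \<and> x - (\<Sum>Y\<in>B. d Y *s y Y) \<in> U"
    have "(\<Sum>Y\<in>B. d Y *s y Y) - (\<Sum>Y\<in>B. c Y *s y Y) \<in> U"
      using subspace_diff[OF U(1) conjunct2[OF c] conjunct2[OF d]] by simp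
    then have "(\<Sum>v\<in>N. (d (v +o U) - c (v +o U)) *s v) \<in> U"
      by (simp add: sum_B sum_subtractf scale_left_diff_distrib)
    from ind[OF this] have "d Y = c Y" if "Y \<in> B" for Y
      using that by (auto simp: B_def)
    then show "c = d" using c d by (intro ext) metis
  qed
  then have "quotient_basis scale V U B"
    by (simp add: quotient_basis_iff[OF U(1) finB BQ yB])
  then show ?thesis ..
qed

lemma quotient_dim_add_dim:
  assumes V: "subspace V" and U: "subspace U" "U \<subseteq> V" and fin: "finite F" "V \<subseteq> span F"
  shows "quotient_dim scale V U + dim_over scale U = dim_over scale V"
proof -
  note card = card_quotient_basis[OF assms]
  obtain B where B: "quotient_basis scale V U B"
    using quotient_basis_exists[OF assms] by blast
  have "quotient_dim scale V U = card B"
    unfolding quotient_dim_def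
  proof (rule the_equality)
    show "\<exists>B'. quotient_basis scale V U B' \<and> card B' = card B" using B by blast
    fix n assume "\<exists>B. quotient_basis scale V U B \<and> card B = n"
    then show "n = card B" using card B by (metis add_right_cancel)
  qed
  then show ?thesis using card[OF B] by simp
qed

end

section \<open>Traces and cell representations\<close>

text \<open>Trace and dual basis are parameters, so that a second pair can be interpreted over the
  same cell datum when the two ideals are compared.\<close>

locale symmetric_cellular_algebra = cellular_algebra scale \<Lambda> M C i
  for scale :: "'r::idom \<Rightarrow> 'a::{ring, monoid_mult} \<Rightarrow> 'a" (infixr \<open>*s\<close> 75)
    and \<Lambda> :: "'l::order set"
    and M :: "'l \<Rightarrow> 'm set"
    and C :: "'l \<Rightarrow> 'm \<Rightarrow> 'm \<Rightarrow> 'a"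
    and i :: "'a \<Rightarrow> 'a" +
  fixes \<tau> :: "'a \<Rightarrow> 'r" and D :: "'l \<Rightarrow> 'm \<Rightarrow> 'm \<Rightarrow> 'a"
  assumes trace: "symmetrizing_trace \<tau>"
    and dual: "dual_basis \<tau> D"
begin

lemma \<tau>_hom: "module_hom scale (*) \<tau>" and \<tau>_commute: "\<tau> (a * b) = \<tau> (b * a)"
proof -
  obtain f where f: "symmetrizing_form f" and \<tau>: "\<tau> = (\<lambda>a. f a 1)"
    using trace by (auto simp: symmetrizing_trace_def)
  show "module_hom scale (*) \<tau>"
    using f by (simp add: symmetrizing_form_def \<tau>)
  have "f (a * b) 1 = f a (b * 1)" for a b
    using f unfolding symmetrizing_form_def by blast
  then have "\<tau> (a * b) = f a b" for a b
    by (simp add: \<tau>)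
  then show "\<tau> (a * b) = \<tau> (b * a)"
    using f by (simp add: symmetrizing_form_def)
qed

lemma \<tau>_add [simp]: "\<tau> (a + b) = \<tau> a + \<tau> b"
  and \<tau>_scale [simp]: "\<tau> (r *s a) = r * \<tau> a"
  and \<tau>_diff [simp]: "\<tau> (a - b) = \<tau> a - \<tau> b"
  and \<tau>_0 [simp]: "\<tau> 0 = 0"
  and \<tau>_sum: "\<tau> (sum g A) = (\<Sum>x\<in>A. \<tau> (g x))"
  using module_hom.add[OF \<tau>_hom] module_hom.scale[OF \<tau>_hom] module_hom.diff[OF \<tau>_hom]
    module_hom.zero[OF \<tau>_hom] module_hom.sum[OF \<tau>_hom] by auto

lemma i_add [simp]: "i (a + b) = i a + i b"
  and i_scale [simp]: "i (r *s a) = r *s i a"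
  and i_diff [simp]: "i (a - b) = i a - i b"
  and i_0 [simp]: "i 0 = 0"
  and i_sum: "i (sum g A) = (\<Sum>x\<in>A. i (g x))"
  using module_hom.add[OF i_linear] module_hom.scale[OF i_linear] module_hom.diff[OF i_linear]
    module_hom.zero[OF i_linear] module_hom.sum[OF i_linear] by auto

lemma finite_cell_index: "finite (cell_index \<Lambda> M)"
proof -
  have "cell_index \<Lambda> M \<subseteq> (SIGMA l:\<Lambda>. M l \<times> M l)"
    by (auto simp: cell_index_def)
  then show ?thesis
    by (rule finite_subset) (use finite_poset finite_M in auto)
qed

lemma pick_in: "l \<in> \<Lambda> \<Longrightarrow> pick l \<in> M l"
  unfolding pick_def using M_nonempty some_in_eq by blast

lemma \<tau>_C_D:
  assumes "l \<in> \<Lambda>" "S \<in> M l" "T \<in> M l" "m \<in> \<Lambda>" "U \<in> M m" "V \<in> M m"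
  shows "\<tau> (C l S T * D m U V) = (if l = m \<and> S = V \<and> T = U then 1 else 0)"
    and "\<tau> (D m U V * C l S T) = (if l = m \<and> S = V \<and> T = U then 1 else 0)"
proof -
  show "\<tau> (C l S T * D m U V) = (if l = m \<and> S = V \<and> T = U then 1 else 0)"
    using dual assms by (auto simp: dual_basis_def cell_index_def)
  then show "\<tau> (D m U V * C l S T) = (if l = m \<and> S = V \<and> T = U then 1 else 0)"
    by (simp only: \<tau>_commute)
qed

lemma basis_family_expand:
  assumes "basis_family b K" "finite K"
  obtains u where "a = (\<Sum>k\<in>K. u k *s b k)"
proof -
  have "a \<in> span (b ` K)" using assms by (auto simp: basis_family_def)
  then obtain u where "a = (\<Sum>v\<in>b ` K. u v *s v)"
    using span_finite[of "b ` K"] assms(2) by auto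
  also have "\<dots> = (\<Sum>k\<in>K. u (b k) *s b k)"
    using assms by (subst sum.reindex) (auto simp: basis_family_def)
  finally show ?thesis by (rule that)
qed

lemma expand_C: "a = (\<Sum>(l, S, T)\<in>cell_index \<Lambda> M. \<tau> (a * D l T S) *s C l S T)"
proof -
  obtain u where u: "a = (\<Sum>k\<in>cell_index \<Lambda> M. u k *s (\<lambda>(l, S, T). C l S T) k)"
    using basis_family_expand[OF C_basis finite_cell_index] .
  have "\<tau> (a * D l T S) = u (l, S, T)" if "(l, S, T) \<in> cell_index \<Lambda> M" for l S T
  proof -
    have "\<tau> (a * D l T S) =
      (\<Sum>k\<in>cell_index \<Lambda> M. u k * \<tau> ((\<lambda>(l, S, T). C l S T) k * D l T S))"
      by (subst u) (simp add: sum_distrib_right \<tau>_sum scale_mult_left)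
    also have "\<dots> = (\<Sum>k\<in>cell_index \<Lambda> M. if k = (l, S, T) then u k else 0)"
      using that by (intro sum.cong refl) (auto simp: cell_index_def \<tau>_C_D split: if_splits)
    finally show ?thesis using that finite_cell_index by simp
  qed
  then show ?thesis
    by (subst u, intro sum.cong refl) (auto split: prod.splits)
qed

lemma expand_D: "a = (\<Sum>(l, S, T)\<in>cell_index \<Lambda> M. \<tau> (a * C l T S) *s D l S T)"
proof -
  have "basis_family (\<lambda>(l, S, T). D l S T) (cell_index \<Lambda> M)"
    using dual by (simp add: dual_basis_def)
  from basis_family_expand[OF this finite_cell_index]
  obtain u where u: "a = (\<Sum>k\<in>cell_index \<Lambda> M. u k *s (\<lambda>(l, S, T). D l S T) k)" .
  have "\<tau> (a * C l T S) = u (l, S, T)" if "(l, S, T) \<in> cell_index \<Lambda> M" for l S T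
  proof -
    have "\<tau> (a * C l T S) =
      (\<Sum>k\<in>cell_index \<Lambda> M. u k * \<tau> ((\<lambda>(l, S, T). D l S T) k * C l T S))"
      by (subst u) (simp add: sum_distrib_right \<tau>_sum scale_mult_left)
    also have "\<dots> = (\<Sum>k\<in>cell_index \<Lambda> M. if k = (l, S, T) then u k else 0)"
      using that by (intro sum.cong refl) (auto simp: cell_index_def \<tau>_C_D split: if_splits)
    finally show ?thesis using that finite_cell_index by simp
  qed
  then show ?thesis
    by (subst u, intro sum.cong refl) (auto split: prod.splits)
qed

text \<open>Non-degeneracy in the form used below: the traces against the C are the coordinates with
  respect to the D.\<close>

lemma trace_eqI:
  assumes "\<And>a. \<tau> (a * x) = \<tau> (a * y)"
  shows "x = y"
proof -
  have "\<tau> (x * a) = \<tau> (y * a)" for a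
    using assms[of a] by (simp only: \<tau>_commute)
  then show ?thesis
    using expand_D[of x] expand_D[of y] by simp
qed

text \<open>The traces against the D are the coordinates with respect to the C, and exactly those
  outside the cells below \<open>l\<close> have to vanish. The pairing thereby tests congruences
  modulo lower cells.\<close>

lemma lower_iff:
  "x \<in> lower l \<longleftrightarrow> (\<forall>m\<in>\<Lambda>. \<forall>U\<in>M m. \<forall>V\<in>M m. \<not> m < l \<longrightarrow> \<tau> (x * D m U V) = 0)"
proof
  assume "x \<in> lower l"
  then show "\<forall>m\<in>\<Lambda>. \<forall>U\<in>M m. \<forall>V\<in>M m. \<not> m < l \<longrightarrow> \<tau> (x * D m U V) = 0"
    unfolding lower_def
    by (induction rule: span_induct_alt)
      (auto simp: distrib_right scale_mult_left \<tau>_C_D)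
next
  assume *: "\<forall>m\<in>\<Lambda>. \<forall>U\<in>M m. \<forall>V\<in>M m. \<not> m < l \<longrightarrow> \<tau> (x * D m U V) = 0"
  have "\<tau> (x * D m T S) *s C m S T \<in> lower l" if "m \<in> \<Lambda>" "S \<in> M m" "T \<in> M m" for m S T
  proof (cases "m < l")
    case True
    then show ?thesis
      unfolding lower_def using that by (intro span_scale span_base) auto
  next
    case False
    then show ?thesis using * that span_zero by (auto simp: lower_def)
  qed
  then show "x \<in> lower l"
    by (subst expand_C) (auto simp: lower_def cell_index_def intro!: span_sum)
qed

lemma subspace_lower: "subspace (lower l)"
  by (simp add: lower_def)

lemma lower_mono: "m < l \<Longrightarrow> lower m \<subseteq> lower l"
  unfolding lower_def by (rule span_mono) (auto intro: less_trans)

lemma C_in_lower: "\<lbrakk>m \<in> \<Lambda>; m < l; S \<in> M m; T \<in> M m\<rbrakk> \<Longrightarrow> C m S T \<in> lower l"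
  unfolding lower_def by (rule span_base) auto

lemma lower_mult_left: "x \<in> lower l \<Longrightarrow> a * x \<in> lower l"
  unfolding lower_def[of l]
proof (induction rule: span_induct_alt)
  case base
  then show ?case by (simp add: span_zero)
next
  case (step c x y)
  then obtain m S T where x: "x = C m S T" "m \<in> \<Lambda>" "m < l" "S \<in> M m" "T \<in> M m" by auto
  obtain r where "a * C m S T - (\<Sum>S'\<in>M m. r S' S *s C m S' T) \<in> lower m"
    using mult_C[OF x(2)] x by blast
  then have "a * C m S T - (\<Sum>S'\<in>M m. r S' S *s C m S' T) \<in> lower l"
    using lower_mono[of m l] x by auto
  moreover have "(\<Sum>S'\<in>M m. r S' S *s C m S' T) \<in> lower l"
    using x by (intro subspace_sum subspace_scale subspace_lower C_in_lower)
  ultimately have "a * x \<in> lower l"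
    using subspace_add[OF subspace_lower] x(1) by fastforce
  then show ?case
    using step subspace_add[OF subspace_lower] subspace_scale[OF subspace_lower]
    by (simp add: distrib_left scale_mult_right lower_def)
qed

lemma lower_i: "x \<in> lower l \<Longrightarrow> i x \<in> lower l"
  unfolding lower_def[of l]
proof (induction rule: span_induct_alt)
  case base
  then show ?case by (simp add: span_zero)
next
  case (step c x y)
  then obtain m S T where x: "x = C m S T" "m \<in> \<Lambda>" "m < l" "S \<in> M m" "T \<in> M m" by auto
  have "i (C m S T) - C m T S \<in> lower l"
    using i_C[of m S T] lower_mono[of m l] x by auto
  moreover have "C m T S \<in> lower l"
    using x by (intro C_in_lower)
  ultimately have "i x \<in> lower l"
    using subspace_add[OF subspace_lower] x(1) by fastforce
  then show ?case
    using step subspace_add[OF subspace_lower] subspace_scale[OF subspace_lower]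
    by (simp add: lower_def)
qed

text \<open>The axioms give only left multiplication; \<open>x * a = i (i a * i x)\<close> turns it
  around.\<close>

lemma lower_mult_right:
  assumes "x \<in> lower l"
  shows "x * a \<in> lower l"
proof -
  have "i (i a * i x) \<in> lower l"
    by (intro lower_i lower_mult_left assms)
  then show ?thesis by (simp add: i_anti i_invol)
qed

text \<open>The coefficient r_a(V,S) of the cell module: the dual basis extracts the coordinate of
  \<open>a * C l S (pick l)\<close> at \<open>C l V (pick l)\<close>. The trace formula replaces a
  choice of the \<open>r\<close> that \<open>mult_C\<close> only asserts to exist.\<close>

definition \<rho> :: "'l \<Rightarrow> 'a \<Rightarrow> 'm \<Rightarrow> 'm \<Rightarrow> 'r" where
  "\<rho> l a V S = \<tau> (a * C l S (pick l) * D l (pick l) V)"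

text \<open>The \<open>r\<close> of the axiom is the same for all \<open>T\<close>, so its value can
  be read off at \<open>T = pick l\<close>, where the trace yields \<open>\<rho>\<close>.\<close>

lemma mult_C_lower:
  assumes "l \<in> \<Lambda>" "S \<in> M l" "T \<in> M l"
  shows "a * C l S T - (\<Sum>S'\<in>M l. \<rho> l a S' S *s C l S' T) \<in> lower l"
proof -
  obtain r where r: "\<And>S T. \<lbrakk>S \<in> M l; T \<in> M l\<rbrakk> \<Longrightarrow>
      a * C l S T - (\<Sum>S'\<in>M l. r S' S *s C l S' T) \<in> lower l"
    using mult_C[OF assms(1)] by blast
  have "\<rho> l a V S = r V S" if "V \<in> M l" for V
  proof -
    have "\<tau> ((a * C l S (pick l) - (\<Sum>S'\<in>M l. r S' S *s C l S' (pick l))) * D l (pick l) V) = 0"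
      using r[OF assms(2) pick_in] assms that pick_in by (auto simp: lower_iff)
    then have "\<rho> l a V S = (\<Sum>S'\<in>M l. r S' S * \<tau> (C l S' (pick l) * D l (pick l) V))"
      by (simp add: \<rho>_def left_diff_distrib sum_distrib_right \<tau>_sum scale_mult_left)
    also have "\<dots> = (\<Sum>S'\<in>M l. if S' = V then r S' S else 0)"
      by (rule sum.cong) (use assms that pick_in in \<open>auto simp: \<tau>_C_D\<close>)
    finally show ?thesis using that assms finite_M by simp
  qed
  then have "(\<Sum>S'\<in>M l. \<rho> l a S' S *s C l S' T) = (\<Sum>S'\<in>M l. r S' S *s C l S' T)"
    by simp
  then show ?thesis using r assms by simp
qed

text \<open>Apply \<open>i\<close> to the left congruence for \<open>i a\<close>; replacing each
  \<open>i (C l T S)\<close> by \<open>C l S T\<close> costs only terms of A(<l), which is a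
  two-sided ideal.\<close>

lemma C_mult_lower:
  assumes "l \<in> \<Lambda>" "S \<in> M l" "T \<in> M l"
  shows "C l S T * a - (\<Sum>T'\<in>M l. \<rho> l (i a) T' T *s C l S T') \<in> lower l"
proof -
  let ?r = "\<lambda>T'. \<rho> l (i a) T' T"
  have "i (i a * C l T S - (\<Sum>T'\<in>M l. ?r T' *s C l T' S)) \<in> lower l"
    by (intro lower_i mult_C_lower assms)
  then have 1: "i (C l T S) * a - (\<Sum>T'\<in>M l. ?r T' *s i (C l T' S)) \<in> lower l"
    by (simp add: i_anti i_invol i_sum)
  have 2: "(i (C l T S) - C l S T) * a \<in> lower l"
    by (intro lower_mult_right i_C assms)
  have 3: "(\<Sum>T'\<in>M l. ?r T' *s (i (C l T' S) - C l S T')) \<in> lower l"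
    by (intro subspace_sum subspace_scale subspace_lower i_C assms)
  have "C l S T * a - (\<Sum>T'\<in>M l. ?r T' *s C l S T') =
    (i (C l T S) * a - (\<Sum>T'\<in>M l. ?r T' *s i (C l T' S)))
    - (i (C l T S) - C l S T) * a + (\<Sum>T'\<in>M l. ?r T' *s (i (C l T' S) - C l S T'))"
    by (simp add: left_diff_distrib scale_right_diff_distrib sum_subtractf)
  then show ?thesis
    using subspace_add[OF subspace_lower subspace_diff[OF subspace_lower 1 2] 3] by (simp only:)
qed

text \<open>For \<open>m\<close> not below \<open>l\<close>, the error term in A(<l) is invisible to
  \<open>D m U V\<close>, so only the coefficients within the cell \<open>l\<close> remain.
  \<open>\<tau>_C_mult_D\<close> is the mirror image.\<close>

lemma \<tau>_mult_C_D:
  assumes "l \<in> \<Lambda>" "S \<in> M l" "T \<in> M l" "m \<in> \<Lambda>" "U \<in> M m" "V \<in> M m" "\<not> m < l"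
  shows "\<tau> (a * C l S T * D m U V) = (if l = m \<and> T = U then \<rho> l a V S else 0)"
proof -
  have "\<tau> ((a * C l S T - (\<Sum>S'\<in>M l. \<rho> l a S' S *s C l S' T)) * D m U V) = 0"
    using mult_C_lower[OF assms(1-3)] assms by (auto simp: lower_iff)
  then have "\<tau> (a * C l S T * D m U V) = (\<Sum>S'\<in>M l. \<rho> l a S' S * \<tau> (C l S' T * D m U V))"
    by (simp add: left_diff_distrib sum_distrib_right \<tau>_sum scale_mult_left)
  also have "\<dots> = (\<Sum>S'\<in>M l. if S' = V then if l = m \<and> T = U then \<rho> l a S' S else 0 else 0)"
    by (rule sum.cong) (use assms in \<open>auto simp: \<tau>_C_D\<close>)
  finally show ?thesis using assms finite_M by auto
qed

lemma \<tau>_C_mult_D: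
  assumes "l \<in> \<Lambda>" "S \<in> M l" "T \<in> M l" "m \<in> \<Lambda>" "U \<in> M m" "V \<in> M m" "\<not> m < l"
  shows "\<tau> (C l S T * a * D m U V) = (if l = m \<and> S = V then \<rho> l (i a) U T else 0)"
proof -
  have "\<tau> ((C l S T * a - (\<Sum>T'\<in>M l. \<rho> l (i a) T' T *s C l S T')) * D m U V) = 0"
    using C_mult_lower[OF assms(1-3)] assms by (auto simp: lower_iff)
  then have "\<tau> (C l S T * a * D m U V) = (\<Sum>T'\<in>M l. \<rho> l (i a) T' T * \<tau> (C l S T' * D m U V))"
    by (simp add: left_diff_distrib sum_distrib_right \<tau>_sum scale_mult_left)
  also have "\<dots> = (\<Sum>T'\<in>M l. if T' = U then if l = m \<and> S = V then \<rho> l (i a) T' T else 0 else 0)"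
    by (rule sum.cong) (use assms in \<open>auto simp: \<tau>_C_D\<close>)
  finally show ?thesis using assms finite_M by auto
qed

definition E :: "'l \<Rightarrow> 'm \<Rightarrow> 'm \<Rightarrow> 'a" where
  "E l S V = C l S (pick l) * D l (pick l) V"

definition F :: "'l \<Rightarrow> 'm \<Rightarrow> 'm \<Rightarrow> 'a" where
  "F l U T = D l U (pick l) * C l (pick l) T"

lemma \<tau>_mult_E: "\<tau> (a * E l S V) = \<rho> l a V S"
  by (simp add: E_def \<rho>_def mult.assoc)

lemma \<tau>_mult_D_C:
  assumes "l \<in> \<Lambda>" "S \<in> M l" "T \<in> M l" "m \<in> \<Lambda>" "U \<in> M m" "V \<in> M m" "\<not> m < l"
  shows "\<tau> (a * (D m U V * C l S T)) = (if l = m \<and> S = V then \<rho> l (i a) U T else 0)"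
  using \<tau>_C_mult_D[OF assms, of a] \<tau>_commute[of "a * D m U V" "C l S T"] by (simp add: mult.assoc)

lemma \<tau>_mult_F: "\<lbrakk>l \<in> \<Lambda>; U \<in> M l; T \<in> M l\<rbrakk> \<Longrightarrow> \<tau> (a * F l U T) = \<rho> l (i a) U T"
  by (simp add: F_def \<tau>_mult_D_C pick_in)

text \<open>The case \<open>l = m\<close>, \<open>T = U\<close> says that the inner index is
  immaterial; the other cases are the orthogonality between cells and within a cell.\<close>

lemma C_mult_D:
  assumes "l \<in> \<Lambda>" "S \<in> M l" "T \<in> M l" "m \<in> \<Lambda>" "U \<in> M m" "V \<in> M m" "\<not> m < l"
  shows "C l S T * D m U V = (if l = m \<and> T = U then E l S V else 0)"
proof (rule trace_eqI)
  fix a show "\<tau> (a * (C l S T * D m U V)) = \<tau> (a * (if l = m \<and> T = U then E l S V else 0))"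
    using \<tau>_mult_C_D[OF assms, of a] by (simp add: \<tau>_mult_E mult.assoc)
qed

lemma D_mult_C:
  assumes "l \<in> \<Lambda>" "S \<in> M l" "T \<in> M l" "m \<in> \<Lambda>" "U \<in> M m" "V \<in> M m" "\<not> m < l"
  shows "D m U V * C l S T = (if l = m \<and> S = V then F l U T else 0)"
proof (rule trace_eqI)
  fix a show "\<tau> (a * (D m U V * C l S T)) = \<tau> (a * (if l = m \<and> S = V then F l U T else 0))"
    using assms by (auto simp: \<tau>_mult_F \<tau>_mult_D_C)
qed

lemma \<rho>_add [simp]: "\<rho> l (a + b) V S = \<rho> l a V S + \<rho> l b V S"
  and \<rho>_diff [simp]: "\<rho> l (a - b) V S = \<rho> l a V S - \<rho> l b V S"
  and \<rho>_scale [simp]: "\<rho> l (r *s a) V S = r * \<rho> l a V S"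
  and \<rho>_0 [simp]: "\<rho> l 0 V S = 0"
  by (simp_all add: \<rho>_def distrib_right left_diff_distrib scale_mult_left)

lemma \<rho>_sum: "\<rho> l (sum g A) V S = (\<Sum>x\<in>A. \<rho> l (g x) V S)"
  by (simp add: \<rho>_def sum_distrib_right \<tau>_sum)

lemma \<rho>_mult:
  assumes "l \<in> \<Lambda>" "V \<in> M l" "S \<in> M l"
  shows "\<rho> l (a * b) V S = (\<Sum>U\<in>M l. \<rho> l a V U * \<rho> l b U S)"
proof -
  let ?d = "b * C l S (pick l) - (\<Sum>U\<in>M l. \<rho> l b U S *s C l U (pick l))"
  have "a * ?d \<in> lower l"
    by (intro lower_mult_left mult_C_lower assms pick_in)
  then have "\<tau> (a * ?d * D l (pick l) V) = 0"
    using assms pick_in by (auto simp: lower_iff)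
  moreover have "a * ?d * D l (pick l) V = a * b * C l S (pick l) * D l (pick l) V
      - (\<Sum>U\<in>M l. \<rho> l b U S *s (a * C l U (pick l) * D l (pick l) V))"
    by (simp add: right_diff_distrib left_diff_distrib sum_distrib_left sum_distrib_right
        scale_mult_left scale_mult_right mult.assoc)
  ultimately have "\<rho> l (a * b) V S = (\<Sum>U\<in>M l. \<rho> l b U S * \<rho> l a V U)"
    by (simp add: \<tau>_sum \<rho>_def)
  then show ?thesis by (simp add: mult.commute)
qed

lemma \<rho>_lower:
  assumes "x \<in> lower l" "l \<in> \<Lambda>" "V \<in> M l" "S \<in> M l"
  shows "\<rho> l x V S = 0"
  using lower_mult_right[OF assms(1)] assms(2-4) pick_in by (auto simp: \<rho>_def lower_iff)

text \<open>A product with left factor \<open>C m S T\<close> has components only in cells up to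
  \<open>m\<close>. This is the source of triangularity in the codimension estimate.\<close>

lemma \<rho>_C_zero:
  assumes "l \<in> \<Lambda>" "U \<in> M l" "V \<in> M l" "m \<in> \<Lambda>" "S \<in> M m" "T \<in> M m" "\<not> l \<le> m"
  shows "\<rho> l (C m S T) U V = 0"
  using \<tau>_C_mult_D[of m S T l "pick l" U "C l V (pick l)"] assms pick_in by (auto simp: \<rho>_def)

section \<open>The nilpotent ideal\<close>

text \<open>Both sides evaluate the trace of \<open>C l S T * C l U V * D l V' S'\<close>, once as
  left multiplication by the first factor and once as right multiplication by the second.\<close>

lemma \<rho>_C_C:
  assumes "l \<in> \<Lambda>" "S \<in> M l" "T \<in> M l" "U \<in> M l" "V \<in> M l" "V' \<in> M l" "S' \<in> M l"
  shows "(if V = V' then \<rho> l (C l S T) S' U else 0) = (if S = S' then \<rho> l (i (C l U V)) V' T else 0)"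
  using \<tau>_mult_C_D[of l U V l V' S' "C l S T"] \<tau>_C_mult_D[of l S T l V' S' "C l U V"] assms
  by simp

lemma \<rho>_C_eq:
  assumes "l \<in> \<Lambda>" "S \<in> M l" "T \<in> M l" "U \<in> M l" "V \<in> M l"
  shows "\<rho> l (C l S T) S U = \<rho> l (i (C l U V)) V T"
  using \<rho>_C_C[of l S T U V V S] assms by simp

lemma \<Phi>_eq:
  assumes "l \<in> \<Lambda>" "S \<in> M l" "T \<in> M l" "U \<in> M l"
  shows "\<Phi> l T U = \<rho> l (C l S T) S U"
  unfolding \<Phi>_def
proof (rule the_equality)
  show "\<forall>S'\<in>M l. \<forall>V\<in>M l. C l S' T * C l U V - \<rho> l (C l S T) S U *s C l S' V \<in> lower l"
  proof (intro ballI)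
    fix S' V assume *: "S' \<in> M l" "V \<in> M l"
    \<comment> \<open>\<open>\<rho>_C_C\<close> kills every row except \<open>S'\<close>, and
      \<open>\<rho>_C_eq\<close>, applied for \<open>S'\<close> and for \<open>S\<close>, shows that
      the remaining entry does not depend on \<open>S'\<close>.\<close>
    have "\<rho> l (C l S' T) X U = (if X = S' then \<rho> l (C l S T) S U else 0)" if "X \<in> M l" for X
      using \<rho>_C_C[of l S' T U V V X] \<rho>_C_eq[of l S' T U V] \<rho>_C_eq[of l S T U V] assms * that
      by (auto split: if_splits)
    then have "(\<Sum>X\<in>M l. \<rho> l (C l S' T) X U *s C l X V)
        = (\<Sum>X\<in>M l. if X = S' then \<rho> l (C l S T) S U *s C l X V else 0)"
      by (intro sum.cong) auto
    also have "\<dots> = \<rho> l (C l S T) S U *s C l S' V"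
      using assms finite_M * by simp
    finally show "C l S' T * C l U V - \<rho> l (C l S T) S U *s C l S' V \<in> lower l"
      using mult_C_lower[of l U V "C l S' T"] assms * by simp
  qed
next
  fix r assume "\<forall>S\<in>M l. \<forall>V\<in>M l. C l S T * C l U V - r *s C l S V \<in> lower l"
  then have "\<tau> ((C l S T * C l U S - r *s C l S S) * D l S S) = 0"
    using assms by (auto simp: lower_iff)
  then show "r = \<rho> l (C l S T) S U"
    using assms \<tau>_mult_C_D[of l U S l S S "C l S T"]
    by (simp add: left_diff_distrib scale_mult_left \<tau>_C_D)
qed

lemma \<rho>_C:
  assumes "l \<in> \<Lambda>" "S \<in> M l" "T \<in> M l" "U \<in> M l" "V \<in> M l"
  shows "\<rho> l (C l S T) V U = (if V = S then \<Phi> l T U else 0)"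
  using \<rho>_C_C[of l S T U V V V] \<Phi>_eq[of l S T U] assms by (auto split: if_splits)

lemma \<rho>_i_C:
  assumes "l \<in> \<Lambda>" "S \<in> M l" "T \<in> M l" "U \<in> M l" "V \<in> M l"
  shows "\<rho> l (i (C l S T)) V U = \<rho> l (C l T S) V U"
  using \<rho>_lower[OF i_C] assms by fastforce

text \<open>\<open>i\<close> fixes \<open>C l U U\<close> modulo lower cells, so
  \<open>\<rho>_C_eq\<close> for the product of \<open>C l T T\<close> and \<open>C l U U\<close>
  exchanges the two arguments.\<close>

lemma \<Phi>_sym:
  assumes "l \<in> \<Lambda>" "T \<in> M l" "U \<in> M l"
  shows "\<Phi> l T U = \<Phi> l U T"
  using \<rho>_C_eq[of l T T U U] \<Phi>_eq[of l T T U] \<Phi>_eq[of l U U T] \<rho>_i_C[of l U U T U] assms by simp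

lemma upper_iff:
  "x \<in> upper D l \<longleftrightarrow> (\<forall>m\<in>\<Lambda>. \<forall>U\<in>M m. \<forall>V\<in>M m. \<not> l < m \<longrightarrow> \<tau> (x * C m U V) = 0)"
proof
  assume "x \<in> upper D l"
  then show "\<forall>m\<in>\<Lambda>. \<forall>U\<in>M m. \<forall>V\<in>M m. \<not> l < m \<longrightarrow> \<tau> (x * C m U V) = 0"
    unfolding upper_def
    by (induction rule: span_induct_alt)
      (auto simp: distrib_right scale_mult_left \<tau>_C_D)
next
  assume *: "\<forall>m\<in>\<Lambda>. \<forall>U\<in>M m. \<forall>V\<in>M m. \<not> l < m \<longrightarrow> \<tau> (x * C m U V) = 0"
  have "\<tau> (x * C m T S) *s D m S T \<in> upper D l" if "m \<in> \<Lambda>" "S \<in> M m" "T \<in> M m" for m S T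
  proof (cases "l < m")
    case True
    then show ?thesis
      unfolding upper_def using that by (intro span_scale span_base) auto
  next
    case False
    then show ?thesis using * that span_zero by (auto simp: upper_def)
  qed
  then show "x \<in> upper D l"
    by (subst expand_D) (auto simp: upper_def cell_index_def intro!: span_sum)
qed

text \<open>By \<open>D_mult_C\<close> only one column survives. To recognize its entries as
  \<open>\<Psi>\<close>, the product D D C is shifted cyclically under the trace to D C D, where
  \<open>\<tau>_mult_C_D\<close> applies.\<close>

lemma \<rho>_D:
  assumes "l \<in> \<Lambda>" "U \<in> M l" "V \<in> M l" "T \<in> M l" "Y \<in> M l"
  shows "\<rho> l (D l U V) T Y = (if V = Y then \<Psi> D l T U else 0)"
proof -
  define \<psi> where "\<psi> = \<tau> (F l U (pick l) * D l (pick l) T)"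
  have \<psi>: "\<rho> l (D l U V) T Y = (if V = Y then \<psi> else 0)" if "V \<in> M l" "Y \<in> M l" for V Y
    using D_mult_C[of l Y "pick l" l U V] assms that pick_in by (simp add: \<rho>_def \<psi>_def)
  have "\<Psi> D l T U = \<psi>"
    unfolding \<Psi>_def
  proof (rule the_equality)
    show "\<forall>S\<in>M l. \<forall>V\<in>M l. D l S T * D l U V - \<psi> *s D l S V \<in> upper D l"
      unfolding upper_iff
    proof (intro ballI impI)
      fix S V m X Y
      assume *: "S \<in> M l" "V \<in> M l" "m \<in> \<Lambda>" "X \<in> M m" "Y \<in> M m" "\<not> l < m"
      have "\<tau> (D l S T * D l U V * C m X Y) = \<tau> (D l U V * C m X Y * D l S T)"
        using \<tau>_commute[of "D l S T" "D l U V * C m X Y"] by (simp add: mult.assoc)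
      also have "\<dots> = (if m = l \<and> Y = S then \<rho> m (D l U V) T X else 0)"
        using * assms by (intro \<tau>_mult_C_D) auto
      also have "\<dots> = \<psi> * \<tau> (D l S V * C m X Y)"
        using * assms by (auto simp: \<psi> \<tau>_C_D)
      finally show "\<tau> ((D l S T * D l U V - \<psi> *s D l S V) * C m X Y) = 0"
        by (simp add: left_diff_distrib scale_mult_left)
    qed
  next
    fix r assume "\<forall>S\<in>M l. \<forall>V\<in>M l. D l S T * D l U V - r *s D l S V \<in> upper D l"
    then have "\<tau> ((D l U T * D l U U - r *s D l U U) * C l U U) = 0"
      using assms by (auto simp: upper_iff)
    moreover have "\<tau> (D l U T * D l U U * C l U U) = \<tau> (D l U U * C l U U * D l U T)"
      using \<tau>_commute[of "D l U T" "D l U U * C l U U"] by (simp add: mult.assoc)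
    moreover have "\<tau> (D l U U * C l U U * D l U T) = \<psi>"
      using \<tau>_mult_C_D[of l U U l U T "D l U U"] assms \<psi> by simp
    ultimately show "r = \<psi>"
      using assms by (simp add: left_diff_distrib scale_mult_left \<tau>_C_D)
  qed
  then show ?thesis using \<psi> assms by simp
qed

lemma \<rho>_C_mult_D:
  assumes "l \<in> \<Lambda>" "S \<in> M l" "V \<in> M l" "V' \<in> M l" "T \<in> M l" "X \<in> M l" "U \<in> M l"
  shows "\<rho> l (C l S V * D l V' T) X U =
    (if X = S \<and> U = T then \<Sum>Y\<in>M l. \<Phi> l V Y * \<Psi> D l Y V' else 0)"
  using assms by (auto simp: \<rho>_mult \<rho>_C \<rho>_D intro!: sum.neutral)

lemma \<rho>_E:
  assumes "l \<in> \<Lambda>" "S \<in> M l" "T \<in> M l" "X \<in> M l" "U \<in> M l"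
  shows "\<rho> l (E l S T) X U = (if X = S \<and> U = T then k_const D l else 0)"
  using assms pick_in[OF assms(1)] \<rho>_C_mult_D[of l S "pick l" "pick l" T X U] \<Phi>_sym[of l "pick l"]
  by (simp add: E_def k_const_def)

text \<open>Compare two evaluations of \<open>C l V V * D l V' V\<close>: as a product of a one-row
  and a one-column matrix, and by \<open>C_mult_D\<close>, which makes it E or 0.\<close>

lemma \<Phi>_\<Psi>:
  assumes "l \<in> \<Lambda>" "V \<in> M l" "V' \<in> M l"
  shows "(\<Sum>Y\<in>M l. \<Phi> l V Y * \<Psi> D l Y V') = (if V = V' then k_const D l else 0)"
  using \<rho>_C_mult_D[of l V V V' V V V] \<rho>_E[of l V V V V] C_mult_D[of l V V l V' V] assms
  by (auto split: if_splits)

text \<open>The inner factor D C annihilates the product of the two E in at least one order, and the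
  trace does not see the order.\<close>

lemma \<rho>_E_other:
  assumes l: "l \<in> \<Lambda>" "S \<in> M l" "T \<in> M l" and m: "m \<in> \<Lambda>" "V \<in> M m" "U \<in> M m" and "l \<noteq> m"
  shows "\<rho> m (E l S T) V U = 0"
proof -
  have *: "E l S T * E m U V = 0"
    if "l \<in> \<Lambda>" "S \<in> M l" "T \<in> M l" "m \<in> \<Lambda>" "V \<in> M m" "U \<in> M m" "l \<noteq> m" "\<not> l < m" for l m S T U V
  proof -
    have "E l S T * E m U V = C l S (pick l) * (D l (pick l) T * C m U (pick m)) * D m (pick m) V"
      by (simp add: E_def mult.assoc)
    then show ?thesis using D_mult_C[of m U "pick m" l "pick l" T] that pick_in by simp
  qed
  have "\<rho> m (E l S T) V U = \<tau> (E l S T * E m U V)"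
    by (simp add: \<tau>_mult_E)
  also have "\<dots> = 0"
  proof (cases "l < m")
    case True
    then show ?thesis using *[of m U V l T S] l m assms(7) by (auto simp: \<tau>_commute[of "E l S T"])
  next
    case False
    then show ?thesis using *[of l S T m V U] l m assms(7) by simp
  qed
  finally show ?thesis .
qed

text \<open>As for E, but the inner factor is now C D, so the condition on the order of the cells is
  reversed.\<close>

lemma \<rho>_i_F_other:
  assumes l: "l \<in> \<Lambda>" "U \<in> M l" "T \<in> M l" and m: "m \<in> \<Lambda>" "V \<in> M m" "S \<in> M m" and "l \<noteq> m"
  shows "\<rho> m (i (F l U T)) V S = 0"
proof -
  have *: "F l U T * F m V S = 0"
    if "l \<in> \<Lambda>" "U \<in> M l" "T \<in> M l" "m \<in> \<Lambda>" "V \<in> M m" "S \<in> M m" "l \<noteq> m" "\<not> m < l" for l m S T U V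
  proof -
    have "F l U T * F m V S = D l U (pick l) * (C l (pick l) T * D m V (pick m)) * C m (pick m) S"
      by (simp add: F_def mult.assoc)
    then show ?thesis using C_mult_D[of l "pick l" T m V "pick m"] that pick_in by simp
  qed
  have "\<rho> m (i (F l U T)) V S = \<tau> (F l U T * F m V S)"
    using m by (simp add: \<tau>_mult_F)
  also have "\<dots> = 0"
  proof (cases "m < l")
    case True
    then show ?thesis using *[of m V S l U T] l m assms(7) by (auto simp: \<tau>_commute[of "F l U T"])
  next
    case False
    then show ?thesis using *[of l U T m V S] l m assms(7) by simp
  qed
  finally show ?thesis .
qed

text \<open>A cyclic shift carries the trace of a product of two F to that of a product of two E, so
  the same constant governs both families.\<close>

lemma \<rho>_i_F:
  assumes "l \<in> \<Lambda>" "U \<in> M l" "T \<in> M l" "V \<in> M l" "S \<in> M l"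
  shows "\<rho> l (i (F l U T)) V S = (if V = T \<and> S = U then k_const D l else 0)"
proof -
  let ?p = "pick l"
  have "\<rho> l (i (F l U T)) V S = \<tau> (F l U T * F l V S)"
    using assms by (simp add: \<tau>_mult_F)
  also have "F l U T * F l V S = D l U ?p * (C l ?p T * D l V ?p) * C l ?p S"
    by (simp add: F_def mult.assoc)
  also have "\<dots> = (if V = T then D l U ?p * (E l ?p ?p * C l ?p S) else 0)"
    using C_mult_D[of l ?p T l V ?p] assms pick_in by (simp add: mult.assoc)
  also have "\<tau> \<dots> = (if V = T then \<tau> (E l ?p ?p * (C l ?p S * D l U ?p)) else 0)"
    using \<tau>_commute[of "D l U ?p" "E l ?p ?p * C l ?p S"] by (simp add: mult.assoc)
  also have "\<dots> = (if V = T \<and> S = U then \<tau> (E l ?p ?p * E l ?p ?p) else 0)"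
    using C_mult_D[of l ?p S l U ?p] assms pick_in by (cases "S = U") simp_all
  also have "\<tau> (E l ?p ?p * E l ?p ?p) = k_const D l"
    using assms pick_in by (simp add: \<tau>_mult_E \<rho>_E)
  finally show ?thesis .
qed

section \<open>Two-sided ideals of square zero\<close>

lemma mult_E:
  assumes "l \<in> \<Lambda>" "S \<in> M l" "V \<in> M l"
  shows "a * E l S V = (\<Sum>S'\<in>M l. \<rho> l a S' S *s E l S' V)"
proof (rule trace_eqI)
  fix b
  have "\<tau> (b * (a * E l S V)) = \<rho> l (b * a) V S"
    using \<tau>_mult_E[of "b * a"] by (simp add: mult.assoc)
  then show "\<tau> (b * (a * E l S V)) = \<tau> (b * (\<Sum>S'\<in>M l. \<rho> l a S' S *s E l S' V))"
    using assms by (simp add: \<rho>_mult sum_distrib_left \<tau>_sum scale_mult_right \<tau>_mult_E mult.commute)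
qed

lemma E_mult:
  assumes "l \<in> \<Lambda>" "S \<in> M l" "V \<in> M l"
  shows "E l S V * a = (\<Sum>V'\<in>M l. \<rho> l a V V' *s E l S V')"
proof (rule trace_eqI)
  fix b
  have "\<tau> (b * (E l S V * a)) = \<tau> (a * b * E l S V)"
    using \<tau>_commute[of a "b * E l S V"] by (simp add: mult.assoc)
  also have "\<dots> = \<rho> l (a * b) V S"
    by (rule \<tau>_mult_E)
  finally show "\<tau> (b * (E l S V * a)) = \<tau> (b * (\<Sum>V'\<in>M l. \<rho> l a V V' *s E l S V'))"
    using assms by (simp add: \<rho>_mult sum_distrib_left \<tau>_sum scale_mult_right \<tau>_mult_E)
qed

lemma mult_F:
  assumes "l \<in> \<Lambda>" "U \<in> M l" "T \<in> M l"
  shows "a * F l U T = (\<Sum>U'\<in>M l. \<rho> l (i a) U U' *s F l U' T)"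
proof (rule trace_eqI)
  fix b
  have "\<tau> (b * (a * F l U T)) = \<rho> l (i a * i b) U T"
    using \<tau>_mult_F[of l U T "b * a"] assms by (simp add: mult.assoc i_anti)
  then show "\<tau> (b * (a * F l U T)) = \<tau> (b * (\<Sum>U'\<in>M l. \<rho> l (i a) U U' *s F l U' T))"
    using assms by (simp add: \<rho>_mult sum_distrib_left \<tau>_sum scale_mult_right \<tau>_mult_F)
qed

lemma F_mult:
  assumes "l \<in> \<Lambda>" "U \<in> M l" "T \<in> M l"
  shows "F l U T * a = (\<Sum>T'\<in>M l. \<rho> l (i a) T' T *s F l U T')"
proof (rule trace_eqI)
  fix b
  have "\<tau> (b * (F l U T * a)) = \<tau> (a * b * F l U T)"
    using \<tau>_commute[of a "b * F l U T"] by (simp add: mult.assoc)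
  also have "\<dots> = \<rho> l (i b * i a) U T"
    using \<tau>_mult_F[of l U T "a * b"] assms by (simp add: i_anti)
  finally show "\<tau> (b * (F l U T * a)) = \<tau> (b * (\<Sum>T'\<in>M l. \<rho> l (i a) T' T *s F l U T'))"
    using assms by (simp add: \<rho>_mult sum_distrib_left \<tau>_sum scale_mult_right \<tau>_mult_F mult.commute)
qed

definition null_index :: "'l set" where
  "null_index = {l \<in> \<Lambda>. k_const D l = 0}"

text \<open>\<open>nil_ideal_eq\<close> shows that this is the C-part of the ideal and
  \<open>nil_F\<close> the D-part; as spans they admit induction over generators.\<close>

definition nil_E :: "'a set" where
  "nil_E = span {E l S U | l S U. l \<in> null_index \<and> S \<in> M l \<and> U \<in> M l}"

definition nil_F :: "'a set" where
  "nil_F = span {F l U S | l U S. l \<in> null_index \<and> U \<in> M l \<and> S \<in> M l}"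

lemma range_double_sum_eq_span:
  fixes x :: "'m \<Rightarrow> 'm \<Rightarrow> 'a"
  assumes "finite A"
  shows "range (\<lambda>r. \<Sum>S\<in>A. \<Sum>U\<in>A. r S U *s x S U) = span {x S U | S U. S \<in> A \<and> U \<in> A}" (is "?R = span ?G")
proof (rule Set.equalityI)
  show "?R \<subseteq> span ?G"
    by (auto intro!: span_sum span_scale intro: span_base)
  have "subspace ?R"
  proof (rule subspaceI)
    show "0 \<in> ?R" by (rule range_eqI[of _ _ "\<lambda>S U. 0"]) simp
    fix y z assume "y \<in> ?R" "z \<in> ?R"
    then obtain r s where "y = (\<Sum>S\<in>A. \<Sum>U\<in>A. r S U *s x S U)" "z = (\<Sum>S\<in>A. \<Sum>U\<in>A. s S U *s x S U)"
      by blast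
    then show "y + z \<in> ?R"
      by (intro range_eqI[of _ _ "\<lambda>S U. r S U + s S U"]) (simp add: scale_left_distrib sum.distrib)
  next
    fix c y assume "y \<in> ?R"
    then obtain r where "y = (\<Sum>S\<in>A. \<Sum>U\<in>A. r S U *s x S U)"
      by blast
    then show "c *s y \<in> ?R"
      by (intro range_eqI[of _ _ "\<lambda>S U. c * r S U"]) (simp add: scale_sum_right)
  qed
  moreover have "x S U \<in> ?R" if "S \<in> A" "U \<in> A" for S U
  proof (rule range_eqI[of _ _ "\<lambda>S' U'. if S' = S \<and> U' = U then 1 else 0"])
    have "(\<Sum>S'\<in>A. \<Sum>U'\<in>A. (if S' = S \<and> U' = U then 1 else 0) *s x S' U') =
      (\<Sum>S'\<in>A. \<Sum>U'\<in>A. if U' = U then if S' = S then x S' U' else 0 else 0)"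
      by (intro sum.cong) auto
    then show "x S U = (\<Sum>S'\<in>A. \<Sum>U'\<in>A. (if S' = S \<and> U' = U then 1 else 0) *s x S' U')"
      using assms that by simp
  qed
  ultimately show "span ?G \<subseteq> ?R"
    by (intro span_minimal) blast+
qed

lemma sum_span_eq_span_Union:
  assumes "finite K"
  shows "(\<Sum>l\<in>K. span (G l)) = span (\<Union>l\<in>K. G l)"
  using assms
proof (induction K rule: finite_induct)
  case empty
  show ?case by (simp add: set_zero)
next
  case (insert l K)
  then show ?case by (auto simp: span_Un set_plus_def)
qed

lemma ideal_C_eq: "l \<in> \<Lambda> \<Longrightarrow> ideal_C D l = span {E l S U | S U. S \<in> M l \<and> U \<in> M l}"
  unfolding ideal_C_def E_def[symmetric] by (intro range_double_sum_eq_span finite_M)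

lemma ideal_D_eq: "l \<in> \<Lambda> \<Longrightarrow> ideal_D D l = span {F l U S | U S. U \<in> M l \<and> S \<in> M l}"
proof -
  assume "l \<in> \<Lambda>"
  then have *: "finite (M l)" by (rule finite_M)
  have "ideal_D D l = range (\<lambda>r. \<Sum>U\<in>M l. \<Sum>S\<in>M l. r U S *s F l U S)"
    unfolding ideal_D_def F_def[symmetric] by (subst sum.swap) rule
  then show ?thesis using range_double_sum_eq_span[OF *] by simp
qed

lemma nil_ideal_eq: "nil_ideal D = nil_E + nil_F"
proof -
  have fin: "finite null_index" using finite_poset by (simp add: null_index_def)
  have "(\<Sum>l\<in>null_index. ideal_C D l) = (\<Sum>l\<in>null_index. span {E l S U | S U. S \<in> M l \<and> U \<in> M l})"
    by (rule sum.cong) (auto simp: ideal_C_eq null_index_def)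
  also have "\<dots> = nil_E"
    unfolding sum_span_eq_span_Union[OF fin] nil_E_def by (rule arg_cong[of _ _ span]) auto
  finally have 1: "(\<Sum>l\<in>null_index. ideal_C D l) = nil_E" .
  have "(\<Sum>l\<in>null_index. ideal_D D l) = (\<Sum>l\<in>null_index. span {F l U S | U S. U \<in> M l \<and> S \<in> M l})"
    by (rule sum.cong) (auto simp: ideal_D_eq null_index_def)
  also have "\<dots> = nil_F"
    unfolding sum_span_eq_span_Union[OF fin] nil_F_def by (rule arg_cong[of _ _ span]) auto
  finally show ?thesis using 1 by (simp add: nil_ideal_def null_index_def)
qed

lemma subspace_nil_E: "subspace nil_E" and subspace_nil_F: "subspace nil_F"
  by (simp_all add: nil_E_def nil_F_def)

lemma E_in_nil_E: "\<lbrakk>l \<in> null_index; S \<in> M l; U \<in> M l\<rbrakk> \<Longrightarrow> E l S U \<in> nil_E"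
  and F_in_nil_F: "\<lbrakk>l \<in> null_index; S \<in> M l; U \<in> M l\<rbrakk> \<Longrightarrow> F l S U \<in> nil_F"
  by (auto simp: nil_E_def nil_F_def intro!: span_base)

lemma null_index_subset: "l \<in> null_index \<Longrightarrow> l \<in> \<Lambda>"
  by (simp add: null_index_def)

lemma nil_E_mult:
  assumes "x \<in> nil_E"
  shows "a * x \<in> nil_E" "x * a \<in> nil_E"
proof -
  have "a * x \<in> nil_E \<and> x * a \<in> nil_E"
    using assms unfolding nil_E_def
  proof (induction rule: span_induct_alt)
    case base
    show ?case by (simp add: span_zero)
  next
    case (step c x y)
    then obtain l S U where x: "x = E l S U" "l \<in> null_index" "S \<in> M l" "U \<in> M l" by auto
    have "a * x \<in> nil_E" "x * a \<in> nil_E"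
      using x null_index_subset
      by (auto simp: mult_E E_mult intro!: subspace_sum subspace_scale subspace_nil_E E_in_nil_E)
    then show ?case
      using step by (auto simp: nil_E_def distrib_left distrib_right scale_mult_left scale_mult_right
          intro!: span_add span_scale)
  qed
  then show "a * x \<in> nil_E" "x * a \<in> nil_E" by auto
qed

lemma nil_F_mult:
  assumes "x \<in> nil_F"
  shows "a * x \<in> nil_F" "x * a \<in> nil_F"
proof -
  have "a * x \<in> nil_F \<and> x * a \<in> nil_F"
    using assms unfolding nil_F_def
  proof (induction rule: span_induct_alt)
    case base
    show ?case by (simp add: span_zero)
  next
    case (step c x y)
    then obtain l S U where x: "x = F l S U" "l \<in> null_index" "S \<in> M l" "U \<in> M l" by auto
    have "a * x \<in> nil_F" "x * a \<in> nil_F"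
      using x null_index_subset
      by (auto simp: mult_F F_mult intro!: subspace_sum subspace_scale subspace_nil_F F_in_nil_F)
    then show ?case
      using step by (auto simp: nil_F_def distrib_left distrib_right scale_mult_left scale_mult_right
          intro!: span_add span_scale)
  qed
  then show "a * x \<in> nil_F" "x * a \<in> nil_F" by auto
qed

text \<open>In its own cell a generator has only the coefficients 0 and k = 0, in other cells none,
  so \<open>nil_E\<close> annihilates all cell modules. Its square is then zero because
  \<open>mult_E\<close> sees the left factor only through its coefficients.\<close>

lemma \<rho>_nil_E:
  assumes "x \<in> nil_E" "m \<in> \<Lambda>" "V \<in> M m" "U \<in> M m"
  shows "\<rho> m x V U = 0"
  using assms(1) unfolding nil_E_def
proof (induction rule: span_induct_alt)
  case base
  show ?case by simp
next
  case (step c x y)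
  then obtain l S T where x: "x = E l S T" "l \<in> \<Lambda>" "k_const D l = 0" "S \<in> M l" "T \<in> M l"
    by (auto simp: null_index_def)
  then have "\<rho> m x V U = 0"
    using assms \<rho>_E_other[of l S T m V U] by (cases "l = m") (auto simp: \<rho>_E)
  then show ?case using step by simp
qed

lemma \<rho>_i_nil_F:
  assumes "x \<in> nil_F" "m \<in> \<Lambda>" "V \<in> M m" "U \<in> M m"
  shows "\<rho> m (i x) V U = 0"
  using assms(1) unfolding nil_F_def
proof (induction rule: span_induct_alt)
  case base
  show ?case by simp
next
  case (step c x y)
  then obtain l S T where x: "x = F l S T" "l \<in> \<Lambda>" "k_const D l = 0" "S \<in> M l" "T \<in> M l"
    by (auto simp: null_index_def)
  then have "\<rho> m (i x) V U = 0"
    using assms \<rho>_i_F_other[of l S T m V U] by (cases "l = m") (auto simp: \<rho>_i_F)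
  then show ?case using step by simp
qed

lemma nil_E_square:
  assumes "x \<in> nil_E" "y \<in> nil_E"
  shows "x * y = 0"
  using assms(2) unfolding nil_E_def
proof (induction rule: span_induct_alt)
  case base
  show ?case by simp
next
  case (step c y z)
  then obtain l S T where "y = E l S T" "l \<in> \<Lambda>" "S \<in> M l" "T \<in> M l"
    by (auto simp: null_index_def)
  then have "x * y = 0" using assms(1) by (simp add: mult_E \<rho>_nil_E)
  then show ?case using step by (simp add: distrib_left scale_mult_right)
qed

lemma nil_F_square:
  assumes "x \<in> nil_F" "y \<in> nil_F"
  shows "x * y = 0"
  using assms(2) unfolding nil_F_def
proof (induction rule: span_induct_alt)
  case base
  show ?case by simp
next
  case (step c y z)
  then obtain l S T where "y = F l S T" "l \<in> \<Lambda>" "S \<in> M l" "T \<in> M l"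
    by (auto simp: null_index_def)
  then have "x * y = 0" using assms(1) by (simp add: mult_F \<rho>_i_nil_F)
  then show ?case using step by (simp add: distrib_left scale_mult_right)
qed

text \<open>Among three factors from two ideals of square zero, two come from the same ideal;
  two-sidedness absorbs the third.\<close>

lemma nil_ideal_cube:
  assumes "x \<in> nil_ideal D" "y \<in> nil_ideal D" "z \<in> nil_ideal D"
  shows "x * y * z = 0"
proof -
  obtain e f e' f' e'' f'' where *:
      "x = e + f" "e \<in> nil_E" "f \<in> nil_F" "y = e' + f'" "e' \<in> nil_E" "f' \<in> nil_F"
      "z = e'' + f''" "e'' \<in> nil_E" "f'' \<in> nil_F"
    using assms by (auto simp: nil_ideal_eq set_plus_def)
  have "x * y = e * f' + f * e'"
    using * by (simp add: distrib_left distrib_right nil_E_square nil_F_square)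
  moreover have "e * f' * e'' = 0" "f * e' * e'' = 0" "e * f' * f'' = 0" "f * e' * f'' = 0"
    using * by (simp_all add: nil_E_square nil_F_square nil_E_mult nil_F_mult)
  ultimately show ?thesis
    unfolding *(7) by (simp add: distrib_left distrib_right)
qed

lemma subspace_nil_ideal: "subspace (nil_ideal D)"
proof -
  have eq: "span nil_E = nil_E" "span nil_F = nil_F"
    using subspace_nil_E subspace_nil_F by (simp_all only: span_eq_iff)
  have "nil_ideal D = span (nil_E \<union> nil_F)"
    unfolding nil_ideal_eq span_Un eq by (auto simp: set_plus_def)
  then show ?thesis by simp
qed

lemma mult_nil_ideal:
  assumes "x \<in> nil_ideal D"
  shows "a * x \<in> nil_ideal D"
proof -
  obtain e f where "x = e + f" "e \<in> nil_E" "f \<in> nil_F"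
    using assms by (auto simp: nil_ideal_eq set_plus_def)
  then show ?thesis
    unfolding nil_ideal_eq using nil_E_mult(1) nil_F_mult(1) by (simp add: distrib_left set_plus_intro)
qed

lemma set_prod_nil_ideal: "set_prod (set_prod (nil_ideal D) (nil_ideal D)) (nil_ideal D) = {0}"
proof -
  have "x * z = 0" if "x \<in> set_prod (nil_ideal D) (nil_ideal D)" "z \<in> nil_ideal D" for x z
    using that(1) unfolding set_prod_def
  proof (induction rule: span_induct_alt)
    case base
    show ?case by simp
  next
    case (step c x y)
    then show ?case using that(2) nil_ideal_cube by (auto simp: distrib_right scale_mult_left)
  qed
  then have "{x * y |x y. x \<in> set_prod (nil_ideal D) (nil_ideal D) \<and> y \<in> nil_ideal D} \<subseteq> {0}"
    by auto
  then show ?thesis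
    unfolding set_prod_def[of "set_prod _ _"] using span_minimal[OF _ subspace_single_0] span_zero by blast
qed

text \<open>If a maximal left ideal missed \<open>x\<close>, then 1 would be the sum of one of its
  elements \<open>j\<close> and a multiple \<open>n = a * x\<close>. As n^3 = 0, the finite
  geometric series is a left inverse of \<open>j = 1 - n\<close>.\<close>

lemma nil_ideal_subset_radical: "nil_ideal D \<subseteq> jacobson_radical"
  unfolding jacobson_radical_def
proof (intro subsetI InterI, rule ccontr)
  fix x J assume x: "x \<in> nil_ideal D" and "J \<in> {J. maximal_left_ideal J}" and "x \<notin> J"
  then have J: "left_ideal J" "J \<noteq> UNIV"
    and max: "\<And>K. \<lbrakk>left_ideal K; J \<subseteq> K; K \<noteq> UNIV\<rbrakk> \<Longrightarrow> K = J"
    unfolding maximal_left_ideal_def by auto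
  have J0: "0 \<in> J" and Jd: "\<And>x y. \<lbrakk>x \<in> J; y \<in> J\<rbrakk> \<Longrightarrow> x - y \<in> J" and Jm: "\<And>a x. x \<in> J \<Longrightarrow> a * x \<in> J"
    using J(1) unfolding left_ideal_def by auto
  define K where "K = {j + a * x | j a. j \<in> J}"
  have "left_ideal K"
    unfolding left_ideal_def
  proof (intro conjI ballI allI)
    show "0 \<in> K" unfolding K_def using J0 by (force intro: exI[of _ 0])
    fix y assume "y \<in> K"
    then obtain j a where y: "y = j + a * x" "j \<in> J" unfolding K_def by blast
    then have "b * y = b * j + (b * a) * x" for b by (simp add: distrib_left mult.assoc)
    then show "b * y \<in> K" for b unfolding K_def using Jm[OF y(2)] by blast
    fix z assume "z \<in> K"
    then obtain j' a' where z: "z = j' + a' * x" "j' \<in> J" unfolding K_def by blast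
    then have "y - z = (j - j') + (a - a') * x" using y by (simp add: algebra_simps)
    then show "y - z \<in> K" unfolding K_def using Jd[OF y(2) z(2)] by blast
  qed
  moreover have "J \<subseteq> K"
  proof
    fix j assume "j \<in> J"
    moreover have "j = j + 0 * x" by simp
    ultimately show "j \<in> K" unfolding K_def by blast
  qed
  moreover have "x \<in> K"
  proof -
    have "x = 0 + 1 * x" by simp
    then show ?thesis unfolding K_def using J0 by blast
  qed
  ultimately have "K = UNIV" using max \<open>x \<notin> J\<close> by blast
  then have "1 \<in> K" by simp
  then obtain j a where j: "1 = j + a * x" "j \<in> J" unfolding K_def by blast
  define n where "n = a * x"
  have n: "n * n * n = 0" unfolding n_def by (intro nil_ideal_cube mult_nil_ideal x)
  have "j = 1 - n" using j(1) by (simp add: n_def eq_diff_eq)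
  then have "(1 + n + n * n) * j = 1 - n * n * n"
    by (simp add: distrib_right right_diff_distrib mult.assoc)
  then have "(1 + n + n * n) * j = 1"
    using n by simp
  then have "1 \<in> J" using Jm[OF j(2)] by metis
  then have "b \<in> J" for b using Jm[of 1 b] by simp
  then show False using J(2) by blast
qed

section \<open>Independence of the symmetrizing trace\<close>

context
  fixes \<tau>' D'
  assumes other: "symmetric_cellular_algebra scale \<Lambda> M C i \<tau>' D'"
begin

interpretation o: symmetric_cellular_algebra scale \<Lambda> M C i \<tau>' D'
  by (rule other)

text \<open>The congruence defining the coefficients involves only the cell datum; it is obtained
  from the second trace and then evaluated with the first.\<close>

lemma \<rho>_other:
  assumes "l \<in> \<Lambda>" "V \<in> M l" "S \<in> M l"
  shows "o.\<rho> l a V S = \<rho> l a V S"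
proof -
  let ?p = "pick l"
  have "\<tau> ((a * C l S ?p - (\<Sum>S'\<in>M l. o.\<rho> l a S' S *s C l S' ?p)) * D l ?p V) = 0"
    using o.mult_C_lower[of l S ?p a] pick_in assms by (auto simp: lower_iff)
  then have "\<rho> l a V S = (\<Sum>S'\<in>M l. o.\<rho> l a S' S * \<tau> (C l S' ?p * D l ?p V))"
    by (simp add: \<rho>_def left_diff_distrib sum_distrib_right \<tau>_sum scale_mult_left)
  also have "\<dots> = (\<Sum>S'\<in>M l. if S' = V then o.\<rho> l a S' S else 0)"
    by (rule sum.cong) (use assms pick_in in \<open>auto simp: \<tau>_C_D\<close>)
  finally show ?thesis using assms finite_M by simp
qed

lemma trace_change: "\<exists>u. \<forall>a. \<tau> a = \<tau>' (a * u)"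
proof (intro exI allI)
  \<comment> \<open>Pairing with the dual basis \<open>D'\<close> under \<open>\<tau>'\<close> gives
    the C-coordinates of \<open>a\<close>; weighting them with the values of \<open>\<tau>\<close>
    on the C yields \<open>\<tau> a\<close>.\<close>
  let ?u = "\<Sum>(l, S, T)\<in>cell_index \<Lambda> M. \<tau> (C l S T) *s D' l T S"
  fix a
  have "\<tau> a = (\<Sum>(l, S, T)\<in>cell_index \<Lambda> M. \<tau>' (a * D' l T S) * \<tau> (C l S T))"
    by (subst o.expand_C) (simp add: \<tau>_sum case_prod_unfold)
  also have "\<dots> = \<tau>' (a * ?u)"
    by (simp add: sum_distrib_left o.\<tau>_sum case_prod_unfold scale_mult_right mult.commute)
  finally show "\<tau> a = \<tau>' (a * ?u)" .
qed

text \<open>Both sides represent the same matrix coefficient under \<open>\<tau>'\<close>, since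
  \<open>\<tau> a = \<tau>' (a * u)\<close>.\<close>

lemma E_F_change:
  obtains u where "\<And>l S V. \<lbrakk>l \<in> \<Lambda>; S \<in> M l; V \<in> M l\<rbrakk> \<Longrightarrow> o.E l S V = E l S V * u"
    and "\<And>l S V. \<lbrakk>l \<in> \<Lambda>; S \<in> M l; V \<in> M l\<rbrakk> \<Longrightarrow> o.F l S V = F l S V * u"
proof -
  obtain u where u: "\<And>a. \<tau> a = \<tau>' (a * u)" using trace_change by blast
  show ?thesis
  proof (rule that)
    fix l S V assume *: "l \<in> \<Lambda>" "S \<in> M l" "V \<in> M l"
    show "o.E l S V = E l S V * u"
    proof (rule o.trace_eqI)
      fix a show "\<tau>' (a * o.E l S V) = \<tau>' (a * (E l S V * u))"
        using u[of "a * E l S V"] * by (simp add: o.\<tau>_mult_E \<tau>_mult_E \<rho>_other mult.assoc)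
    qed
    show "o.F l S V = F l S V * u"
    proof (rule o.trace_eqI)
      fix a show "\<tau>' (a * o.F l S V) = \<tau>' (a * (F l S V * u))"
        using u[of "a * F l S V"] * by (simp add: o.\<tau>_mult_F \<tau>_mult_F \<rho>_other mult.assoc)
    qed
  qed
qed

text \<open>The new constant is a diagonal coefficient of \<open>E l (pick l) (pick l) * u\<close>,
  and E has no nonzero coefficients on its cell module when k = 0.\<close>

lemma k_const_change:
  assumes "l \<in> \<Lambda>" "k_const D l = 0"
  shows "k_const D' l = 0"
proof -
  obtain u where u: "\<And>l S V. \<lbrakk>l \<in> \<Lambda>; S \<in> M l; V \<in> M l\<rbrakk> \<Longrightarrow> o.E l S V = E l S V * u"
    using E_F_change by metis
  let ?p = "pick l"
  have p: "?p \<in> M l" using assms pick_in by simp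
  have "k_const D' l = \<rho> l (E l ?p ?p * u) ?p ?p"
    using o.\<rho>_E[of l ?p ?p ?p ?p] assms p by (simp add: \<rho>_other u)
  also have "\<dots> = 0" using assms p by (auto simp: \<rho>_mult \<rho>_E intro!: sum.neutral)
  finally show ?thesis .
qed

end

lemma nil_ideal_mono:
  assumes other: "symmetric_cellular_algebra scale \<Lambda> M C i \<tau>' D'"
  shows "nil_ideal D' \<subseteq> nil_ideal D"
proof -
  interpret o: symmetric_cellular_algebra scale \<Lambda> M C i \<tau>' D'
    by (rule other)
  have self: "symmetric_cellular_algebra scale \<Lambda> M C i \<tau> D"
    by unfold_locales
  \<comment> \<open>\<open>k_const_change\<close> is used with the two traces exchanged.\<close>
  have null: "l \<in> null_index" if "l \<in> o.null_index" for l
    using that o.k_const_change[OF self] by (simp add: null_index_def o.null_index_def)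
  obtain u where u: "\<And>l S V. \<lbrakk>l \<in> \<Lambda>; S \<in> M l; V \<in> M l\<rbrakk> \<Longrightarrow> o.E l S V = E l S V * u"
    "\<And>l S V. \<lbrakk>l \<in> \<Lambda>; S \<in> M l; V \<in> M l\<rbrakk> \<Longrightarrow> o.F l S V = F l S V * u"
    using E_F_change[OF other] by metis
  have "o.nil_E \<subseteq> nil_E"
    unfolding o.nil_E_def
    by (rule span_minimal[OF _ subspace_nil_E])
      (auto simp: u null_index_subset dest!: null intro!: nil_E_mult E_in_nil_E)
  moreover have "o.nil_F \<subseteq> nil_F"
    unfolding o.nil_F_def
    by (rule span_minimal[OF _ subspace_nil_F])
      (auto simp: u null_index_subset dest!: null intro!: nil_F_mult F_in_nil_F)
  ultimately show ?thesis
    unfolding nil_ideal_eq o.nil_ideal_eq by (rule set_plus_mono2)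
qed

end

section \<open>The forms on the cell modules\<close>

text \<open>Induction on the height \<open>h k\<close>: in the equation for \<open>k\<close>, all
  other nonzero entries multiply unknowns of smaller height, which already vanish.\<close>

lemma unitriangular_system:
  fixes A :: "'k \<Rightarrow> 'k \<Rightarrow> 'r::comm_ring_1" and h :: "'k \<Rightarrow> nat"
  assumes K: "finite K" and diag: "\<And>k. k \<in> K \<Longrightarrow> A k k = 1"
    and off: "\<And>k k'. \<lbrakk>k \<in> K; k' \<in> K; k \<noteq> k'; A k k' \<noteq> 0\<rbrakk> \<Longrightarrow> h k' < h k"
    and eq: "\<And>k. k \<in> K \<Longrightarrow> (\<Sum>k'\<in>K. c k' * A k k') = 0"
  shows "\<forall>k\<in>K. c k = 0"
proof
  fix k assume "k \<in> K"
  then show "c k = 0"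
  proof (induction "h k" arbitrary: k rule: less_induct)
    case less
    have "c k' * A k k' = 0" if "k' \<in> K - {k}" for k'
      using less off[of k k'] that by fastforce
    then have "(\<Sum>k'\<in>K. c k' * A k k') = c k * A k k"
      using K less.prems by (subst sum.remove) auto
    then show ?case using eq diag less.prems by simp
  qed
qed

lemma sum_fun_apply: "(\<Sum>x\<in>A. f x) S = (\<Sum>x\<in>A. f x S)"
  by (induction A rule: infinite_finite_induct) auto

context symmetric_cellular_algebra
begin

definition unit_vec :: "'m \<Rightarrow> 'm \<Rightarrow> 'r" where
  "unit_vec T = (\<lambda>S. if S = T then 1 else 0)"

text \<open>The functional that \<open>x\<close> induces through the cell form, recorded by its
  values on the basis. Cutting it off outside \<open>M l\<close> makes it a vector of
  \<open>W l\<close> again.\<close>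

definition form_left :: "'l \<Rightarrow> ('m \<Rightarrow> 'r) \<Rightarrow> 'm \<Rightarrow> 'r" where
  "form_left l x = (\<lambda>T. if T \<in> M l then \<Sum>S\<in>M l. x S * \<Phi> l S T else 0)"

lemma module_scaleW: "Modules.module scaleW"
  by unfold_locales (auto simp: scaleW_def fun_eq_iff algebra_simps)

lemma cell_form_eq: "cell_form l x y = (\<Sum>T\<in>M l. form_left l x T * y T)"
  unfolding cell_form_def
  by (subst sum.swap) (simp add: form_left_def sum_distrib_left sum_distrib_right ac_simps)

lemma cell_form_sym: "l \<in> \<Lambda> \<Longrightarrow> cell_form l x y = cell_form l y x"
  unfolding cell_form_def by (subst sum.swap) (intro sum.cong refl, simp add: \<Phi>_sym mult.commute)

lemma unit_vec_in_W: "T \<in> M l \<Longrightarrow> unit_vec T \<in> W l"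
  by (auto simp: W_def unit_vec_def)

lemma form_left_in_W: "form_left l x \<in> W l"
  by (simp add: W_def form_left_def)

lemma sum_mult_unit_vec: "l \<in> \<Lambda> \<Longrightarrow> T \<in> M l \<Longrightarrow> (\<Sum>S\<in>M l. f S * unit_vec T S) = f T"
  using finite_M by (simp add: unit_vec_def if_distrib cong: if_cong)

lemma expand_unit_vec:
  assumes "l \<in> \<Lambda>" "x \<in> W l"
  shows "x = (\<Sum>T\<in>M l. scaleW (x T) (unit_vec T))"
proof
  fix S
  have "(\<Sum>T\<in>M l. x T * unit_vec T S) = (\<Sum>T\<in>M l. if T = S then x T else 0)"
    by (rule sum.cong) (auto simp: unit_vec_def)
  then show "x S = (\<Sum>T\<in>M l. scaleW (x T) (unit_vec T)) S"
    using assms finite_M by (auto simp: sum_fun_apply scaleW_def W_def)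
qed

lemma cell_rad_iff:
  assumes "l \<in> \<Lambda>"
  shows "x \<in> cell_rad l \<longleftrightarrow> x \<in> W l \<and> form_left l x = 0"
proof
  assume x: "x \<in> cell_rad l"
  have "form_left l x T = 0" for T
  proof (cases "T \<in> M l")
    case True
    then have "cell_form l x (unit_vec T) = 0"
      using x unit_vec_in_W by (auto simp: cell_rad_def)
    then show ?thesis
      using sum_mult_unit_vec[OF assms True, of "form_left l x"] by (simp add: cell_form_eq)
  qed (simp add: form_left_def)
  then show "x \<in> W l \<and> form_left l x = 0"
    using x by (auto simp: cell_rad_def)
next
  assume "x \<in> W l \<and> form_left l x = 0"
  then show "x \<in> cell_rad l" by (simp add: cell_rad_def cell_form_eq)
qed

text \<open>Multiplying the vanishing functional of a radical vector \<open>x\<close> by the matrix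
  of \<open>\<Psi>\<close> gives k times \<open>x\<close>, by \<open>\<Phi>_\<Psi>\<close>, and the
  scalars have no zero divisors.\<close>

lemma cell_rad_trivial:
  assumes l: "l \<in> \<Lambda>" and k: "k_const D l \<noteq> 0"
  shows "cell_rad l = {0}"
proof -
  have "x = 0" if "x \<in> cell_rad l" for x
  proof
    fix V
    have x: "x \<in> W l" "form_left l x = 0"
      using that l by (simp_all add: cell_rad_iff)
    show "x V = 0 V"
    proof (cases "V \<in> M l")
      case True
      have "0 = (\<Sum>Y\<in>M l. form_left l x Y * \<Psi> D l Y V)"
        by (simp add: x(2))
      also have "\<dots> = (\<Sum>Y\<in>M l. \<Sum>S\<in>M l. x S * (\<Phi> l S Y * \<Psi> D l Y V))"
        by (simp add: form_left_def sum_distrib_right mult.assoc)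
      also have "\<dots> = (\<Sum>S\<in>M l. x S * (\<Sum>Y\<in>M l. \<Phi> l S Y * \<Psi> D l Y V))"
        by (subst sum.swap) (simp add: sum_distrib_left)
      also have "\<dots> = (\<Sum>S\<in>M l. if S = V then x S * k_const D l else 0)"
        by (rule sum.cong) (use l True in \<open>auto simp: \<Phi>_\<Psi>\<close>)
      also have "\<dots> = x V * k_const D l"
        using l True finite_M by simp
      finally show ?thesis using k by simp
    qed (use x in \<open>simp add: W_def\<close>)
  qed
  moreover have "0 \<in> cell_rad l"
    using l by (simp add: cell_rad_iff W_def form_left_def fun_eq_iff)
  ultimately show ?thesis by blast
qed

text \<open>A nonzero k forces a trivial radical, so k vanishes on \<open>\<Lambda>2\<close> and
  \<open>\<Lambda>3\<close>. That \<open>\<Lambda>1\<close> lies in \<open>\<Lambda>0\<close> rests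
  on \<open>M l\<close> being nonempty.\<close>

lemma \<Lambda>_decomposition:
  "null_index = \<Lambda>2 \<union> \<Lambda>3 \<union> \<Lambda>4 D" "\<Lambda> = \<Lambda>2 \<union> \<Lambda>3 \<union> \<Lambda>1"
  "\<Lambda>2 \<inter> \<Lambda>3 = {}" "(\<Lambda>2 \<union> \<Lambda>3) \<inter> \<Lambda>1 = {}"
proof -
  have 1: "\<Lambda>1 \<subseteq> \<Lambda>0"
  proof
    fix l assume l: "l \<in> \<Lambda>1"
    then have l': "l \<in> \<Lambda>" "pick l \<in> M l" and rad: "cell_rad l = {0}"
      using pick_in by (auto simp: \<Lambda>1_def)
    have "unit_vec (pick l) \<noteq> 0"
      by (simp add: unit_vec_def fun_eq_iff)
    then have "unit_vec (pick l) \<notin> cell_rad l" using rad by simp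
    then show "l \<in> \<Lambda>0"
      using l' unit_vec_in_W by (auto simp: cell_rad_def \<Lambda>0_def)
  qed
  show "null_index = \<Lambda>2 \<union> \<Lambda>3 \<union> \<Lambda>4 D"
    using 1 cell_rad_trivial by (auto simp: null_index_def \<Lambda>2_def \<Lambda>3_def \<Lambda>4_def \<Lambda>1_def \<Lambda>0_def)
  show "\<Lambda> = \<Lambda>2 \<union> \<Lambda>3 \<union> \<Lambda>1" "\<Lambda>2 \<inter> \<Lambda>3 = {}" "(\<Lambda>2 \<union> \<Lambda>3) \<inter> \<Lambda>1 = {}"
    using 1 by (auto simp: \<Lambda>2_def \<Lambda>3_def \<Lambda>1_def \<Lambda>0_def)
qed

text \<open>
  \<open>J\<close> spans a complement of the radical, \<open>\<xi> p\<close> is the coordinate functional of \<open>p \<in> B\<close>, and for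
  \<open>p \<in> J\<close> the vector \<open>y p\<close> represents this functional by the cell form.
\<close>

definition adapted_basis ::
    "'l \<Rightarrow> ('m \<Rightarrow> 'r) set \<Rightarrow> ('m \<Rightarrow> 'r) set \<Rightarrow> (('m \<Rightarrow> 'r) \<Rightarrow> 'm \<Rightarrow> 'r) \<Rightarrow> (('m \<Rightarrow> 'r) \<Rightarrow> 'm \<Rightarrow> 'r) \<Rightarrow> bool" where
  "adapted_basis l B J \<xi> y \<longleftrightarrow>
     finite B \<and> card B = card (M l) \<and> J \<subseteq> B \<and> card J = dim_L l \<and>
     (\<forall>p\<in>B. \<forall>b\<in>B. (\<Sum>T\<in>M l. b T * \<xi> p T) = (if b = p then 1 else 0)) \<and>
     (\<forall>p\<in>J. \<forall>b\<in>B. cell_form l b (y p) = (if b = p then 1 else 0))"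

context
  assumes field: "\<And>x::'r. x \<noteq> 0 \<Longrightarrow> x dvd 1"
begin

interpretation cm: module_over_field scaleW
  by (intro module_over_field.intro module_over_field_axioms.intro module_scaleW field)

interpretation am: module_over_field scale
  by (intro module_over_field.intro module_over_field_axioms.intro field) unfold_locales

lemma subspace_W: "cm.subspace (W l)"
  by (rule cm.subspaceI) (auto simp: W_def scaleW_def)

lemma W_span:
  assumes "l \<in> \<Lambda>"
  shows "W l \<subseteq> cm.span (unit_vec ` M l)"
proof
  fix x assume "x \<in> W l"
  then show "x \<in> cm.span (unit_vec ` M l)"
    by (subst expand_unit_vec[OF assms]) (auto intro!: cm.span_sum cm.span_scale intro: cm.span_base)
qed

lemma dim_W:
  assumes "l \<in> \<Lambda>"
  shows "dim_over scaleW (W l) = card (M l)"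
proof -
  have ind: "\<forall>T\<in>M l. c T = 0" if "(\<Sum>T\<in>M l. scaleW (c T) (unit_vec T)) = 0" for c
  proof
    fix S assume S: "S \<in> M l"
    have "(\<Sum>T\<in>M l. c T * unit_vec T S) = (\<Sum>T\<in>M l. if T = S then c T else 0)"
      by (rule sum.cong) (auto simp: unit_vec_def)
    then have "(\<Sum>T\<in>M l. scaleW (c T) (unit_vec T)) S = c S"
      using S assms finite_M by (simp add: sum_fun_apply scaleW_def)
    then show "c S = 0" using that by simp
  qed
  note fam = cm.independent_family[OF finite_M[OF assms] ind]
  have "card (unit_vec ` M l) = dim_over scaleW (W l)"
    by (rule cm.vs.basis_card_eq_dim) (use fam W_span[OF assms] unit_vec_in_W in auto)
  then show ?thesis using card_image[OF fam(1)] by simp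
qed

lemma subspace_cell_rad:
  assumes "l \<in> \<Lambda>"
  shows "cm.subspace (cell_rad l)" "cell_rad l \<subseteq> W l"
proof -
  show "cell_rad l \<subseteq> W l" by (auto simp: cell_rad_def)
  show "cm.subspace (cell_rad l)"
    by (rule cm.subspaceI)
      (auto simp: cell_rad_def W_def scaleW_def cell_form_def distrib_right sum.distrib mult.assoc
        simp flip: sum_distrib_left)
qed

lemma dim_L_add_dim_rad: "l \<in> \<Lambda> \<Longrightarrow> dim_L l + dim_rad l = card (M l)"
  unfolding dim_L_def dim_rad_def
  using cm.quotient_dim_add_dim[OF subspace_W subspace_cell_rad _ W_span] finite_M dim_W by simp

lemma representation_pairing:
  assumes l: "l \<in> \<Lambda>" and B: "cm.independent B" "W l \<subseteq> cm.span B" and v: "v \<in> W l"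
  shows "(\<Sum>T\<in>M l. v T * cm.representation B (unit_vec T) p) = cm.representation B v p"
proof -
  have "cm.representation B v p = cm.representation B (\<Sum>T\<in>M l. scaleW (v T) (unit_vec T)) p"
    using expand_unit_vec[OF l v] by simp
  also have "\<dots> = (\<Sum>T\<in>M l. v T * cm.representation B (unit_vec T) p)"
    using B unit_vec_in_W by (subst cm.representation_sum) (auto simp: cm.representation_scale subset_eq intro!: cm.span_scale)
  finally show ?thesis ..
qed

text \<open>A basis \<open>R\<close> of the radical is extended by \<open>J\<close> to a basis of
  the cell module. The functionals \<open>form_left l p\<close> for \<open>p\<close> in
  \<open>J\<close> are independent and are extended to a basis \<open>B'\<close> in turn, whose
  coordinate functionals supply \<open>y\<close>.\<close>

lemma adapted_basis_exists:
  assumes l: "l \<in> \<Lambda>"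
  shows "\<exists>B J \<xi> y. adapted_basis l B J \<xi> y"
proof -
  obtain R where R: "R \<subseteq> cell_rad l" "cm.independent R" "cell_rad l \<subseteq> cm.span R"
    using cm.vs.maximal_independent_subset[of "cell_rad l"] by blast
  have RW: "R \<subseteq> W l" using R(1) subspace_cell_rad(2)[OF l] by auto
  obtain B where B: "R \<subseteq> B" "B \<subseteq> W l" "cm.independent B" "W l \<subseteq> cm.span B"
    using cm.vs.maximal_independent_subset_extend[OF RW R(2)] by blast
  have finU: "finite (unit_vec ` M l)" using finite_M[OF l] by simp
  have finB: "finite B"
    using cm.vs.independent_span_bound[OF finU B(3)] B(2) W_span[OF l] by blast
  have finR: "finite R" using finB B(1) finite_subset by blast
  have spanR: "cm.span R = cell_rad l"
    using R subspace_cell_rad(1)[OF l] cm.span_minimal by blast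
  have cardB: "card B = card (M l)"
    using cm.vs.basis_card_eq_dim[OF B(2,4,3)] dim_W[OF l] by simp
  have cardR: "card R = dim_rad l"
    using cm.vs.basis_card_eq_dim[OF R(1,3,2)] by (simp add: dim_rad_def)
  define J where "J = B - R"
  have cardJ: "card J = dim_L l"
    unfolding J_def using card_Diff_subset[OF finR B(1)] cardB cardR dim_L_add_dim_rad[OF l] by simp
  have finJ: "finite J" and JB: "J \<inter> R = {}" "J \<union> R = B" using finB B(1) by (auto simp: J_def)
  \<comment> \<open>A relation among the functionals is a combination of \<open>J\<close> lying in
    the radical, and \<open>J\<close> is independent modulo \<open>R\<close>.\<close>
  have ind: "\<forall>j\<in>J. c j = 0" if "(\<Sum>j\<in>J. scaleW (c j) (form_left l j)) = 0" for c
  proof -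
    let ?x = "\<Sum>j\<in>J. scaleW (c j) j"
    have "form_left l ?x T = (\<Sum>j\<in>J. scaleW (c j) (form_left l j)) T" for T
      unfolding form_left_def sum_fun_apply scaleW_def
      by (auto simp: sum_distrib_right sum_distrib_left mult.assoc intro: sum.swap)
    then have "form_left l ?x = 0"
      using that by auto
    moreover have "?x \<in> W l"
      using B(2) by (intro cm.subspace_sum[OF subspace_W] cm.subspace_scale[OF subspace_W]) (auto simp: J_def)
    ultimately have "?x \<in> cm.span R"
      using spanR l by (simp add: cell_rad_iff)
    then show ?thesis
      using cm.independent_complement[OF finJ finR JB(1)] B(3) JB(2) by blast
  qed
  note fam = cm.independent_family[OF finJ ind]
  have "form_left l ` J \<subseteq> W l" using form_left_in_W by auto
  then obtain B' where B': "form_left l ` J \<subseteq> B'" "B' \<subseteq> W l" "cm.independent B'" "W l \<subseteq> cm.span B'"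
    using cm.vs.maximal_independent_subset_extend[OF _ fam(2)] by blast
  define \<xi> where "\<xi> = (\<lambda>p T. cm.representation B (unit_vec T) p)"
  \<comment> \<open>Pairing \<open>y p\<close> with \<open>form_left l b\<close> extracts the
    coordinate of the latter at \<open>form_left l p\<close>.\<close>
  define y where "y = (\<lambda>p T. cm.representation B' (unit_vec T) (form_left l p))"
  have "(\<Sum>T\<in>M l. b T * \<xi> p T) = (if b = p then 1 else 0)" if "p \<in> B" "b \<in> B" for p b
  proof -
    have "(\<Sum>T\<in>M l. b T * \<xi> p T) = cm.representation B b p"
      unfolding \<xi>_def using that B by (intro representation_pairing l) auto
    then show ?thesis using cm.representation_basis[OF B(3) that(2)] by auto
  qed
  moreover have "cell_form l b (y p) = (if b = p then 1 else 0)" if p: "p \<in> J" and b: "b \<in> B" for p b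
  proof -
    have *: "cell_form l b (y p) = cm.representation B' (form_left l b) (form_left l p)"
      unfolding cell_form_eq y_def by (rule representation_pairing[OF l B'(3,4) form_left_in_W])
    show ?thesis
    proof (cases "b \<in> J")
      case True
      then have "form_left l b \<in> B'" using B'(1) by blast
      then have "cell_form l b (y p) = (if form_left l p = form_left l b then 1 else 0)"
        unfolding * by (simp add: cm.representation_basis[OF B'(3)])
      moreover have "form_left l p = form_left l b \<longleftrightarrow> p = b"
        using fam(1) True p by (auto dest: inj_onD)
      ultimately show ?thesis by auto
    next
      case False
      then have "b \<in> cell_rad l" using b JB R(1) by auto
      then have "form_left l b = 0" using l by (simp add: cell_rad_iff)
      then have "cell_form l b (y p) = 0" unfolding * by (simp add: cm.representation_zero)
      then show ?thesis using False p by auto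
    qed
  qed
  ultimately have "adapted_basis l B J \<xi> y"
    unfolding adapted_basis_def using finB cardB cardJ JB by blast
  then show ?thesis by blast
qed

end

section \<open>Dimension estimates\<close>

text \<open>C, and below E and F, extended bilinearly to vectors, so that an adapted basis can
  replace the standard basis of the cell module.\<close>

definition C_vec :: "'l \<Rightarrow> ('m \<Rightarrow> 'r) \<Rightarrow> ('m \<Rightarrow> 'r) \<Rightarrow> 'a" where
  "C_vec l x z = (\<Sum>S\<in>M l. \<Sum>T\<in>M l. (x S * z T) *s C l S T)"

definition E_vec :: "'l \<Rightarrow> ('m \<Rightarrow> 'r) \<Rightarrow> ('m \<Rightarrow> 'r) \<Rightarrow> 'a" where
  "E_vec l y \<xi> = (\<Sum>S\<in>M l. \<Sum>V\<in>M l. (y S * \<xi> V) *s E l S V)"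

definition F_vec :: "'l \<Rightarrow> ('m \<Rightarrow> 'r) \<Rightarrow> ('m \<Rightarrow> 'r) \<Rightarrow> 'a" where
  "F_vec l \<xi> y = (\<Sum>U\<in>M l. \<Sum>T\<in>M l. (\<xi> U * y T) *s F l U T)"

lemma double_sum_delta:
  fixes f :: "'m \<Rightarrow> 'm \<Rightarrow> 'r"
  assumes "finite A" "V \<in> A"
  shows "(\<Sum>S\<in>A. \<Sum>T\<in>A. f S T * (if V = S then g T else 0)) = (\<Sum>T\<in>A. f V T * g T)"
    and "(\<Sum>S\<in>A. \<Sum>T\<in>A. f S T * (if V = T then g S else 0)) = (\<Sum>S\<in>A. f S V * g S)"
proof -
  have "(\<Sum>S\<in>A. \<Sum>T\<in>A. f S T * (if V = S then g T else 0)) = (\<Sum>S\<in>A. if V = S then \<Sum>T\<in>A. f S T * g T else 0)"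
    by (rule sum.cong) auto
  then show "(\<Sum>S\<in>A. \<Sum>T\<in>A. f S T * (if V = S then g T else 0)) = (\<Sum>T\<in>A. f V T * g T)"
    using assms by simp
  have "(\<Sum>S\<in>A. \<Sum>T\<in>A. f S T * (if V = T then g S else 0)) = (\<Sum>S\<in>A. \<Sum>T\<in>A. if V = T then f S T * g S else 0)"
    by (intro sum.cong) auto
  then show "(\<Sum>S\<in>A. \<Sum>T\<in>A. f S T * (if V = T then g S else 0)) = (\<Sum>S\<in>A. f S V * g S)"
    using assms by simp
qed

lemma \<rho>_C_vec:
  assumes "l \<in> \<Lambda>" "V \<in> M l" "U \<in> M l"
  shows "\<rho> l (C_vec l x z) V U = x V * form_left l z U"
proof -
  have "\<rho> l (C_vec l x z) V U =
    (\<Sum>S\<in>M l. \<Sum>T\<in>M l. (x S * z T) * (if V = S then \<Phi> l T U else 0))"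
    unfolding C_vec_def using assms by (simp add: \<rho>_sum \<rho>_C)
  also have "\<dots> = (\<Sum>T\<in>M l. x V * z T * \<Phi> l T U)"
    using assms finite_M by (subst double_sum_delta) auto
  finally show ?thesis
    using assms by (simp add: form_left_def sum_distrib_left mult.assoc)
qed

lemma \<rho>_i_C_vec:
  assumes "l \<in> \<Lambda>" "V \<in> M l" "U \<in> M l"
  shows "\<rho> l (i (C_vec l x z)) V U = z V * form_left l x U"
proof -
  have "\<rho> l (i (C_vec l x z)) V U =
    (\<Sum>S\<in>M l. \<Sum>T\<in>M l. (x S * z T) * (if V = T then \<Phi> l S U else 0))"
    unfolding C_vec_def using assms by (simp add: \<rho>_sum i_sum \<rho>_i_C \<rho>_C)
  also have "\<dots> = (\<Sum>S\<in>M l. x S * z V * \<Phi> l S U)"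
    using assms finite_M by (subst double_sum_delta) auto
  finally show ?thesis
    using assms by (simp add: form_left_def sum_distrib_left ac_simps)
qed

text \<open>The pairing factors: \<open>x\<close> meets the coordinate vector, \<open>z\<close>
  meets the cell form. With F the two slots are exchanged, so E and F together reach pairs of basis
  vectors of which just one lies outside the radical.\<close>

lemma \<tau>_C_vec_E_vec:
  assumes "l \<in> \<Lambda>"
  shows "\<tau> (C_vec l x z * E_vec l y \<xi>) = (\<Sum>T\<in>M l. x T * \<xi> T) * cell_form l z y"
proof -
  have "\<tau> (C_vec l x z * E_vec l y \<xi>) =
    (\<Sum>S\<in>M l. \<Sum>V\<in>M l. (y S * \<xi> V) * (x V * form_left l z S))"
    unfolding E_vec_def using assms
    by (simp add: sum_distrib_left \<tau>_sum scale_mult_right \<tau>_mult_E \<rho>_C_vec)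
  also have "\<dots> = (\<Sum>S\<in>M l. \<Sum>V\<in>M l. (x V * \<xi> V) * (form_left l z S * y S))"
    by (simp add: ac_simps)
  also have "\<dots> = (\<Sum>T\<in>M l. x T * \<xi> T) * cell_form l z y"
    unfolding cell_form_eq by (subst sum.swap) (simp add: sum_product)
  finally show ?thesis .
qed

lemma \<tau>_C_vec_F_vec:
  assumes "l \<in> \<Lambda>"
  shows "\<tau> (C_vec l x z * F_vec l \<xi> y) = (\<Sum>T\<in>M l. z T * \<xi> T) * cell_form l x y"
proof -
  have "\<tau> (C_vec l x z * F_vec l \<xi> y) =
    (\<Sum>U\<in>M l. \<Sum>T\<in>M l. (\<xi> U * y T) * (z U * form_left l x T))"
    unfolding F_vec_def using assms
    by (simp add: sum_distrib_left \<tau>_sum scale_mult_right \<tau>_mult_F \<rho>_i_C_vec)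
  also have "\<dots> = (\<Sum>U\<in>M l. \<Sum>T\<in>M l. (z U * \<xi> U) * (form_left l x T * y T))"
    by (simp add: ac_simps)
  also have "\<dots> = (\<Sum>T\<in>M l. z T * \<xi> T) * cell_form l x y"
    unfolding cell_form_eq by (simp add: sum_product)
  finally show ?thesis .
qed

lemma \<tau>_C_other:
  assumes "l \<in> \<Lambda>" "S \<in> M l" "T \<in> M l" "m \<in> \<Lambda>" "U \<in> M m" "V \<in> M m" "l \<noteq> m" "\<not> m < l"
  shows "\<tau> (C l S T * E m U V) = 0" "\<tau> (C l S T * F m U V) = 0"
proof -
  have "\<tau> (C l S T * E m U V) = \<tau> (C m U (pick m) * (D m (pick m) V * C l S T))"
    using \<tau>_commute[of "C l S T" "E m U V"] by (simp add: E_def mult.assoc)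
  then show "\<tau> (C l S T * E m U V) = 0"
    using D_mult_C[of l S T m "pick m" V] assms pick_in by simp
  have "\<tau> (C l S T * F m U V) = \<tau> ((C l S T * D m U (pick m)) * C m (pick m) V)"
    by (simp add: F_def mult.assoc)
  then show "\<tau> (C l S T * F m U V) = 0"
    using C_mult_D[of l S T m U "pick m"] assms pick_in by simp
qed

lemma \<tau>_C_vec_other:
  assumes "l \<in> \<Lambda>" "m \<in> \<Lambda>" "l \<noteq> m" "\<not> m < l"
  shows "\<tau> (C_vec l x z * E_vec m y \<xi>) = 0" "\<tau> (C_vec l x z * F_vec m \<xi> y) = 0"
  unfolding C_vec_def E_vec_def F_vec_def sum_distrib_left sum_distrib_right \<tau>_sum
  using assms by (auto simp: scale_mult_left scale_mult_right \<tau>_C_other intro!: sum.neutral)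

lemma E_vec_in_nil_ideal: "l \<in> null_index \<Longrightarrow> E_vec l y \<xi> \<in> nil_ideal D"
proof -
  assume "l \<in> null_index"
  then have "E_vec l y \<xi> \<in> nil_E"
    unfolding E_vec_def by (intro subspace_sum subspace_scale subspace_nil_E E_in_nil_E)
  then show ?thesis
    using subspace_0[OF subspace_nil_F] unfolding nil_ideal_eq by (metis add.right_neutral set_plus_intro)
qed

lemma F_vec_in_nil_ideal: "l \<in> null_index \<Longrightarrow> F_vec l \<xi> y \<in> nil_ideal D"
proof -
  assume "l \<in> null_index"
  then have "F_vec l \<xi> y \<in> nil_F"
    unfolding F_vec_def by (intro subspace_sum subspace_scale subspace_nil_F F_in_nil_F)
  then show ?thesis
    using subspace_0[OF subspace_nil_E] unfolding nil_ideal_eq by (metis add.left_neutral set_plus_intro)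
qed

text \<open>Contravariance of the cell form, \<Phi>(x, a y) = \<Phi>(i(a) x, y), obtained by
  computing a coefficient of \<open>C l T T * a\<close> in two ways.\<close>

lemma \<Phi>_\<rho>:
  assumes "l \<in> \<Lambda>" "T \<in> M l" "U \<in> M l"
  shows "(\<Sum>X\<in>M l. \<Phi> l T X * \<rho> l a X U) = (\<Sum>T'\<in>M l. \<rho> l (i a) T' T * \<Phi> l T' U)"
proof -
  have "\<rho> l (C l T T * a - (\<Sum>T'\<in>M l. \<rho> l (i a) T' T *s C l T T')) T U = 0"
    using assms by (intro \<rho>_lower C_mult_lower)
  then have "\<rho> l (C l T T * a) T U = (\<Sum>T'\<in>M l. \<rho> l (i a) T' T * \<Phi> l T' U)"
    using assms by (simp add: \<rho>_sum \<rho>_C)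
  then show ?thesis using assms by (simp add: \<rho>_mult \<rho>_C)
qed

text \<open>The value \<open>\<Phi>\<^sub>l (y, a b)\<close> of the form on the cell module.\<close>

definition head_coeff :: "'l \<Rightarrow> ('m \<Rightarrow> 'r) \<Rightarrow> ('m \<Rightarrow> 'r) \<Rightarrow> 'a \<Rightarrow> 'r" where
  "head_coeff l y b a = (\<Sum>T\<in>M l. \<Sum>U\<in>M l. y T * b U * (\<Sum>X\<in>M l. \<Phi> l T X * \<rho> l a X U))"

lemma head_coeff_sum: "head_coeff l y b (\<Sum>k\<in>K. c k *s x k) = (\<Sum>k\<in>K. c k * head_coeff l y b (x k))"
proof -
  have "head_coeff l y b (u *s a + v) = u * head_coeff l y b a + head_coeff l y b v" for u a v
    by (simp add: head_coeff_def distrib_left sum.distrib sum_distrib_left ac_simps)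
  moreover have "head_coeff l y b 0 = 0"
    by (simp add: head_coeff_def)
  ultimately show ?thesis
    by (induction K rule: infinite_finite_induct) auto
qed

text \<open>The part in \<open>nil_E\<close> acts as zero; for the part in \<open>nil_F\<close> it
  is \<open>i f\<close> that acts as zero, and contravariance moves it to the other
  argument.\<close>

lemma head_coeff_nil_ideal:
  assumes l: "l \<in> \<Lambda>" and "x \<in> nil_ideal D"
  shows "head_coeff l y b x = 0"
proof -
  obtain e f where ef: "x = e + f" "e \<in> nil_E" "f \<in> nil_F"
    using assms by (auto simp: nil_ideal_eq set_plus_def)
  have "(\<Sum>X\<in>M l. \<Phi> l T X * \<rho> l x X U) = 0" if "T \<in> M l" "U \<in> M l" for T U
  proof -
    have "(\<Sum>X\<in>M l. \<Phi> l T X * \<rho> l x X U) = (\<Sum>X\<in>M l. \<Phi> l T X * \<rho> l f X U)"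
      using ef l that by (simp add: \<rho>_nil_E)
    also have "\<dots> = 0"
      using \<Phi>_\<rho>[OF l that, of f] ef l that by (simp add: \<rho>_i_nil_F)
    finally show ?thesis .
  qed
  then show ?thesis by (simp add: head_coeff_def)
qed

text \<open>\<open>C_vec l x z\<close> sends \<open>b\<close> to the multiple \<Phi>(z, b) of
  \<open>x\<close>, a map of rank at most one.\<close>

lemma head_coeff_C_vec:
  assumes "l \<in> \<Lambda>"
  shows "head_coeff l y b (C_vec l x z) = cell_form l x y * cell_form l z b"
proof -
  have "head_coeff l y b (C_vec l x z) =
    (\<Sum>T\<in>M l. \<Sum>U\<in>M l. (y T * (\<Sum>X\<in>M l. \<Phi> l T X * x X)) * (form_left l z U * b U))"
    unfolding head_coeff_def using assms
    by (intro sum.cong refl) (simp add: \<rho>_C_vec sum_distrib_left sum_distrib_right ac_simps)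
  also have "\<dots> = (\<Sum>T\<in>M l. y T * (\<Sum>X\<in>M l. \<Phi> l T X * x X)) * cell_form l z b"
    unfolding cell_form_eq by (simp add: sum_product)
  also have "(\<Sum>T\<in>M l. y T * (\<Sum>X\<in>M l. \<Phi> l T X * x X)) = cell_form l y x"
    by (simp add: cell_form_def sum_distrib_left ac_simps)
  finally show ?thesis using cell_form_sym[OF assms] by simp
qed

lemma head_coeff_C_vec_other:
  assumes "l \<in> \<Lambda>" "m \<in> \<Lambda>" "\<not> l \<le> m"
  shows "head_coeff l y b (C_vec m x z) = 0"
  using assms by (auto simp: head_coeff_def C_vec_def \<rho>_sum \<rho>_C_zero intro!: sum.neutral)

section \<open>Dimension and codimension of the nilpotent ideal over a field\<close>

context
  assumes field: "\<And>x::'r. x \<noteq> 0 \<Longrightarrow> x dvd 1"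
begin

interpretation am: module_over_field scale
  by (intro module_over_field.intro module_over_field_axioms.intro field) unfold_locales

lemma dim_bounds:
  shows "(\<Sum>l\<in>null_index. (card (M l) + dim_rad l) * dim_L l) \<le> dim_over scale (nil_ideal D)"
    and "(\<Sum>l\<in>\<Lambda>. (dim_L l)\<^sup>2) + dim_over scale (nil_ideal D) \<le> (\<Sum>l\<in>\<Lambda>. (card (M l))\<^sup>2)"
proof -
  have "\<forall>l. \<exists>B J \<xi> y. l \<in> \<Lambda> \<longrightarrow> adapted_basis l B J \<xi> y"
    using adapted_basis_exists[OF field] by blast
  then obtain B J \<xi> y where bas: "\<And>l. l \<in> \<Lambda> \<Longrightarrow> adapted_basis l (B l) (J l) (\<xi> l) (y l)"
    by metis
  have fin: "finite (B l)" "finite (J l)" and JB: "J l \<subseteq> B l"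
    and card: "card (B l) = card (M l)" "card (J l) = dim_L l" if "l \<in> \<Lambda>" for l
    using bas[OF that] finite_subset by (auto simp: adapted_basis_def)
  have \<xi>: "(\<Sum>T\<in>M l. b T * \<xi> l p T) = (if b = p then 1 else 0)" if "l \<in> \<Lambda>" "p \<in> B l" "b \<in> B l" for l p b
    using bas[OF that(1)] that by (simp add: adapted_basis_def)
  have y: "cell_form l b (y l p) = (if b = p then 1 else 0)" if "l \<in> \<Lambda>" "p \<in> J l" "b \<in> B l" for l p b
    using bas[OF that(1)] that by (simp add: adapted_basis_def)

  let ?G = "(\<lambda>(l, S, T). C l S T) ` cell_index \<Lambda> M"
  have G: "finite ?G" "span ?G = UNIV"
    using C_basis finite_cell_index by (auto simp: basis_family_def)
  have "cell_index \<Lambda> M = (SIGMA l:\<Lambda>. M l \<times> M l)"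
    by (auto simp: cell_index_def)
  then have cardG: "card ?G = (\<Sum>l\<in>\<Lambda>. (card (M l))\<^sup>2)"
    using C_basis finite_poset finite_M
    by (simp add: basis_family_def card_image card_cartesian_product power2_eq_square)

  have fin_null: "finite null_index" using finite_poset by (simp add: null_index_def)
  \<comment> \<open>Pairs with at least one entry in \<open>J l\<close>, the only ones detected by
    the pairing; with n = \<open>card (M l)\<close> and r = \<open>dim_rad l\<close> there are n^2 -
    r^2 of them.\<close>
  define K where "K = (SIGMA l:null_index. B l \<times> B l - (B l - J l) \<times> (B l - J l))"
  \<comment> \<open>The entry known to lie in \<open>J l\<close> goes to the slot of the cell form:
    \<open>q\<close> for E, and otherwise \<open>p\<close> for F.\<close>
  define x where "x = (\<lambda>(l, p, q). if q \<in> J l then E_vec l (y l q) (\<xi> l p) else F_vec l (\<xi> l q) (y l p))"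
  define t where "t = (\<lambda>(l, p, q) a. \<tau> (C_vec l p q * a))"
  \<comment> \<open>A nonzero test between different cells leads to a strictly smaller cell, so the
    number of cells below decreases.\<close>
  define h where "h = (\<lambda>(l, p::'m \<Rightarrow> 'r, q::'m \<Rightarrow> 'r). card {m \<in> \<Lambda>. m < l})"
  have finK: "finite K"
    unfolding K_def using fin_null fin null_index_subset by auto
  have t_sum: "t k (\<Sum>k'\<in>K. c k' *s x k') = (\<Sum>k'\<in>K. c k' * t k (x k'))" for c k K x
    by (cases k) (simp add: t_def sum_distrib_left \<tau>_sum scale_mult_right)
  have t_same: "t (l, p, q) (x (l, p', q')) = (if p = p' \<and> q = q' then 1 else 0)"
    if "(l, p, q) \<in> K" "(l, p', q') \<in> K" for l p q p' q'
    using that null_index_subset JB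
    by (auto simp: K_def t_def x_def \<tau>_C_vec_E_vec \<tau>_C_vec_F_vec \<xi> y)
  have h_less: "h k' < h k" if k: "k \<in> K" "k' \<in> K" "k \<noteq> k'" "t k (x k') \<noteq> 0" for k k'
  proof -
    obtain l p q where k1: "k = (l, p, q)" by (cases k)
    obtain l' p' q' where k2: "k' = (l', p', q')" by (cases k')
    have l: "l \<in> \<Lambda>" "l' \<in> \<Lambda>" using k k1 k2 null_index_subset by (auto simp: K_def)
    have "l \<noteq> l'" using t_same k k1 k2 by (auto split: if_splits)
    have "l' < l"
    proof (rule ccontr)
      assume "\<not> l' < l"
      note \<tau>_C_vec_other[OF l \<open>l \<noteq> l'\<close> this]
      then show False using k(4) by (simp add: k1 k2 t_def x_def split: if_splits)
    qed
    then have "{m \<in> \<Lambda>. m < l'} \<subset> {m \<in> \<Lambda>. m < l}"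
      using l by (auto intro: less_trans)
    then show ?thesis
      using finite_poset by (simp add: h_def k1 k2 psubset_card_mono)
  qed
  have "card K \<le> dim_over scale (nil_ideal D)"
  proof (rule am.card_le_dim[OF G(1) _ finK])
    show "nil_ideal D \<subseteq> span ?G" using G(2) by simp
    show "x k \<in> nil_ideal D" if "k \<in> K" for k
      using that E_vec_in_nil_ideal F_vec_in_nil_ideal by (auto simp: K_def x_def split: if_splits)
    fix c assume c: "(\<Sum>k\<in>K. c k *s x k) = 0"
    show "\<forall>k\<in>K. c k = 0"
    proof (rule unitriangular_system[OF finK, where A = "\<lambda>k k'. t k (x k')" and h = h])
      show "t k (x k) = 1" if "k \<in> K" for k
        using that t_same by (cases k) auto
      show "(\<Sum>k'\<in>K. c k' * t k (x k')) = 0" for k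
        unfolding t_sum[symmetric] c by (cases k) (simp add: t_def)
    qed (rule h_less)
  qed
  moreover have "card K = (\<Sum>l\<in>null_index. (card (M l) + dim_rad l) * dim_L l)"
  proof -
    have "card (B l \<times> B l - (B l - J l) \<times> (B l - J l)) = (card (M l) + dim_rad l) * dim_L l"
      if "l \<in> null_index" for l
    proof -
      have l: "l \<in> \<Lambda>" using that by (rule null_index_subset)
      have "card (B l - J l) = dim_rad l"
        using card_Diff_subset[OF fin(2)[OF l] JB[OF l]] card[OF l] dim_L_add_dim_rad[OF field l] by simp
      moreover have "card (B l \<times> B l - (B l - J l) \<times> (B l - J l)) =
          card (B l) * card (B l) - card (B l - J l) * card (B l - J l)"
        using fin[OF l] by (subst card_Diff_subset) (auto simp: card_cartesian_product)
      moreover have n: "card (M l) = dim_L l + dim_rad l"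
        using dim_L_add_dim_rad[OF field l] by simp
      \<comment> \<open>The identity n^2 - r^2 = (n + r)(n - r) with n - r = \<open>dim_L l\<close>,
        written additively because subtraction of naturals truncates.\<close>
      moreover have "card (M l) * card (M l) = (card (M l) + dim_rad l) * dim_L l + dim_rad l * dim_rad l"
        unfolding n by (simp add: algebra_simps)
      ultimately show ?thesis
        using card(1)[OF l] by simp
    qed
    then show ?thesis
      unfolding K_def using fin_null fin null_index_subset by (subst card_SigmaI) auto
  qed
  ultimately show "(\<Sum>l\<in>null_index. (card (M l) + dim_rad l) * dim_L l) \<le> dim_over scale (nil_ideal D)"
    by simp

  define K' where "K' = (SIGMA l:\<Lambda>. J l \<times> J l)"
  \<comment> \<open>With \<open>y l q\<close> in the second slot, \<open>head_coeff_C_vec\<close>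
    turns the tests \<open>t'\<close> within a cell into products of two Kronecker deltas.\<close>
  define x' where "x' = (\<lambda>(l, p, q). C_vec l p (y l q))"
  define t' where "t' = (\<lambda>(l, p, q). head_coeff l (y l p) q)"
  \<comment> \<open>Here a nonzero test between different cells leads upwards in the order, hence
    the cells above are counted.\<close>
  define h' where "h' = (\<lambda>(l, p::'m \<Rightarrow> 'r, q::'m \<Rightarrow> 'r). card {m \<in> \<Lambda>. l < m})"
  have finK': "finite K'"
    unfolding K'_def using finite_poset fin by auto
  have t'_same: "t' (l, p, q) (x' (l, p', q')) = (if p = p' \<and> q = q' then 1 else 0)"
    if "(l, p, q) \<in> K'" "(l, p', q') \<in> K'" for l p q p' q'
    using that JB by (auto simp: K'_def t'_def x'_def head_coeff_C_vec y subset_eq cell_form_sym[of l "y l q'"])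
  have h'_less: "h' k' < h' k" if k: "k \<in> K'" "k' \<in> K'" "k \<noteq> k'" "t' k (x' k') \<noteq> 0" for k k'
  proof -
    obtain l p q where k1: "k = (l, p, q)" by (cases k)
    obtain l' p' q' where k2: "k' = (l', p', q')" by (cases k')
    have l: "l \<in> \<Lambda>" "l' \<in> \<Lambda>" using k k1 k2 by (auto simp: K'_def)
    have "l \<noteq> l'" using t'_same k k1 k2 by (auto split: if_splits)
    moreover have "l \<le> l'"
      using k(4) l head_coeff_C_vec_other[of l l'] by (auto simp: k1 k2 t'_def x'_def)
    ultimately have "l < l'" by (rule le_neq_trans[rotated])
    then have "{m \<in> \<Lambda>. l' < m} \<subset> {m \<in> \<Lambda>. l < m}"
      using l by (auto intro: less_trans)
    then show ?thesis
      using finite_poset by (simp add: h'_def k1 k2 psubset_card_mono)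
  qed
  have "card K' + dim_over scale (nil_ideal D) \<le> card ?G"
  proof (rule am.card_add_dim_le[OF G(1) subspace_nil_ideal _ finK'])
    show "nil_ideal D \<subseteq> span ?G" and "x' k \<in> span ?G" for k using G(2) by simp_all
    fix c assume c: "(\<Sum>k\<in>K'. c k *s x' k) \<in> nil_ideal D"
    show "\<forall>k\<in>K'. c k = 0"
    proof (rule unitriangular_system[OF finK', where A = "\<lambda>k k'. t' k (x' k')" and h = h'])
      show "t' k (x' k) = 1" if "k \<in> K'" for k
        using that t'_same by (cases k) auto
      show "(\<Sum>k'\<in>K'. c k' * t' k (x' k')) = 0" if "k \<in> K'" for k
        using that head_coeff_nil_ideal[OF _ c]
        by (cases k) (auto simp: t'_def K'_def head_coeff_sum)
    qed (rule h'_less)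
  qed
  moreover have "card K' = (\<Sum>l\<in>\<Lambda>. (dim_L l)\<^sup>2)"
    unfolding K'_def using finite_poset fin card
    by (subst card_SigmaI) (auto simp: card_cartesian_product power2_eq_square)
  ultimately show "(\<Sum>l\<in>\<Lambda>. (dim_L l)\<^sup>2) + dim_over scale (nil_ideal D) \<le> (\<Sum>l\<in>\<Lambda>. (card (M l))\<^sup>2)"
    using cardG by simp
qed

interpretation cm: module_over_field scaleW
  by (intro module_over_field.intro module_over_field_axioms.intro module_scaleW field)

lemma dim_rad_\<Lambda>1: "l \<in> \<Lambda>1 \<Longrightarrow> dim_rad l = 0"
  using cm.vs.dim_span_eq_card_independent[OF cm.independent_empty] by (simp add: dim_rad_def \<Lambda>1_def)

lemma dim_L_\<Lambda>3:
  assumes "l \<in> \<Lambda>3"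
  shows "dim_L l = 0"
proof -
  have l: "l \<in> \<Lambda>" and "cell_rad l = W l"
    using assms by (auto simp: \<Lambda>3_def \<Lambda>0_def cell_rad_def)
  then have "dim_rad l = card (M l)"
    using dim_W[OF field l] by (simp add: dim_rad_def)
  then show ?thesis
    using dim_L_add_dim_rad[OF field l] by simp
qed

text \<open>In the sum over the cells with k = 0, the factor \<open>dim_L\<close> removes
  \<open>\<Lambda>3\<close>, and on \<open>\<Lambda>4 D\<close> the trivial radical leaves
  n^2.\<close>

lemma dim_nil_ideal_ge:
  "dim_over scale (nil_ideal D) \<ge>
    (\<Sum>l\<in>\<Lambda>2. (card (M l) + dim_rad l) * dim_L l) + (\<Sum>l\<in>\<Lambda>4 D. (card (M l))\<^sup>2)"
proof -
  have disj: "(\<Lambda>2 \<union> \<Lambda>3) \<inter> \<Lambda>4 D = {}"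
    using \<Lambda>_decomposition(4) by (auto simp: \<Lambda>4_def)
  have fin: "finite \<Lambda>2" "finite \<Lambda>3" "finite (\<Lambda>4 D)"
    using finite_poset by (auto simp: \<Lambda>2_def \<Lambda>3_def \<Lambda>4_def \<Lambda>0_def \<Lambda>1_def)
  let ?f = "\<lambda>l. (card (M l) + dim_rad l) * dim_L l"
  have "sum ?f null_index = sum ?f \<Lambda>2 + sum ?f \<Lambda>3 + sum ?f (\<Lambda>4 D)"
    unfolding \<Lambda>_decomposition(1) using fin disj \<Lambda>_decomposition(3) by (simp add: sum.union_disjoint)
  moreover have "sum ?f \<Lambda>3 = 0" by (simp add: dim_L_\<Lambda>3)
  moreover have "sum ?f (\<Lambda>4 D) = (\<Sum>l\<in>\<Lambda>4 D. (card (M l))\<^sup>2)"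
  proof (rule sum.cong)
    fix l assume "l \<in> \<Lambda>4 D"
    then have "l \<in> \<Lambda>" "dim_rad l = 0" using dim_rad_\<Lambda>1 by (auto simp: \<Lambda>4_def \<Lambda>1_def)
    then show "?f l = (card (M l))\<^sup>2"
      using dim_L_add_dim_rad[OF field, of l] by (simp add: power2_eq_square)
  qed rule
  ultimately show ?thesis using dim_bounds(1) by simp
qed

text \<open>In the combined bounds the cells of \<open>\<Lambda>1\<close> cancel, those of
  \<open>\<Lambda>3\<close> contribute only n^2, and on \<open>\<Lambda>2\<close> the rest of n^2
  after (n + r) dim L is r^2. Integers keep the two differences from being truncated.\<close>

lemma dimension_inequality:
  "(\<Sum>l\<in>\<Lambda>2. (int (dim_L l))\<^sup>2) - (\<Sum>l\<in>\<Lambda>3. (int (card (M l)))\<^sup>2)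
    \<le> (\<Sum>l\<in>\<Lambda>2. (int (dim_rad l))\<^sup>2) - (\<Sum>l\<in>\<Lambda>4 D. (int (card (M l)))\<^sup>2)"
proof -
  have fin: "finite \<Lambda>2" "finite \<Lambda>3" "finite \<Lambda>1"
    using finite_poset by (auto simp: \<Lambda>2_def \<Lambda>3_def \<Lambda>0_def \<Lambda>1_def)
  have split: "sum f \<Lambda> = sum f \<Lambda>2 + sum f \<Lambda>3 + sum f \<Lambda>1" for f :: "'l \<Rightarrow> int"
    by (subst \<Lambda>_decomposition(2)) (use fin \<Lambda>_decomposition(3,4) in \<open>simp add: sum.union_disjoint\<close>)
  let ?n = "\<lambda>l. int (card (M l))" and ?L = "\<lambda>l. int (dim_L l)" and ?r = "\<lambda>l. int (dim_rad l)"
  have n: "?n l = ?L l + ?r l" if "l \<in> \<Lambda>" for l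
    using dim_L_add_dim_rad[OF field that] by simp
  have "(\<Sum>l\<in>\<Lambda>. (dim_L l)\<^sup>2) + ((\<Sum>l\<in>\<Lambda>2. (card (M l) + dim_rad l) * dim_L l)
      + (\<Sum>l\<in>\<Lambda>4 D. (card (M l))\<^sup>2)) \<le> (\<Sum>l\<in>\<Lambda>. (card (M l))\<^sup>2)"
    using dim_bounds(2) dim_nil_ideal_ge by linarith
  then have "int ((\<Sum>l\<in>\<Lambda>. (dim_L l)\<^sup>2) + ((\<Sum>l\<in>\<Lambda>2. (card (M l) + dim_rad l) * dim_L l)
      + (\<Sum>l\<in>\<Lambda>4 D. (card (M l))\<^sup>2))) \<le> int (\<Sum>l\<in>\<Lambda>. (card (M l))\<^sup>2)"
    by (simp only: of_nat_le_iff)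
  then have "(\<Sum>l\<in>\<Lambda>. (?L l)\<^sup>2) + (\<Sum>l\<in>\<Lambda>2. (?n l + ?r l) * ?L l) + (\<Sum>l\<in>\<Lambda>4 D. (?n l)\<^sup>2)
      \<le> (\<Sum>l\<in>\<Lambda>. (?n l)\<^sup>2)"
    by simp
  moreover have "(\<Sum>l\<in>\<Lambda>3. (?L l)\<^sup>2) = 0" by (simp add: dim_L_\<Lambda>3)
  moreover have "(\<Sum>l\<in>\<Lambda>1. (?L l)\<^sup>2) = (\<Sum>l\<in>\<Lambda>1. (?n l)\<^sup>2)"
    by (rule sum.cong) (auto simp: n dim_rad_\<Lambda>1 \<Lambda>1_def)
  ultimately have "(\<Sum>l\<in>\<Lambda>2. (?L l)\<^sup>2) + (\<Sum>l\<in>\<Lambda>2. (?n l + ?r l) * ?L l) + (\<Sum>l\<in>\<Lambda>4 D. (?n l)\<^sup>2)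
      \<le> (\<Sum>l\<in>\<Lambda>2. (?n l)\<^sup>2) + (\<Sum>l\<in>\<Lambda>3. (?n l)\<^sup>2)"
    by (simp add: split)
  moreover have "(\<Sum>l\<in>\<Lambda>2. (?n l)\<^sup>2) = (\<Sum>l\<in>\<Lambda>2. (?n l + ?r l) * ?L l) + (\<Sum>l\<in>\<Lambda>2. (?r l)\<^sup>2)"
    unfolding sum.distrib[symmetric]
  proof (rule sum.cong)
    fix l assume "l \<in> \<Lambda>2"
    then have "l \<in> \<Lambda>" by (auto simp: \<Lambda>2_def \<Lambda>0_def)
    then show "(?n l)\<^sup>2 = (?n l + ?r l) * ?L l + (?r l)\<^sup>2"
      by (simp add: n power2_eq_square algebra_simps)
  qed rule
  ultimately show ?thesis by linarith
qed

end

end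

theorem theorem4p2:
  fixes scale :: "'r::idom \<Rightarrow> 'a::{ring, monoid_mult} \<Rightarrow> 'a"
    and \<Lambda> :: "'l::order set"
    and M :: "'l \<Rightarrow> 'm set"
    and C D :: "'l \<Rightarrow> 'm \<Rightarrow> 'm \<Rightarrow> 'a"
    and i :: "'a \<Rightarrow> 'a"
    and \<tau> :: "'a \<Rightarrow> 'r"
  assumes "cellular_algebra scale \<Lambda> M C i"
    and "unital_algebra.symmetrizing_trace scale \<tau>"
    and "cellular_algebra.dual_basis scale \<Lambda> M C \<tau> D"
  shows
    "cellular_algebra.nil_ideal scale \<Lambda> M C D \<subseteq> jacobson_radical \<and>
     unital_algebra.set_prod scale
       (unital_algebra.set_prod scale
         (cellular_algebra.nil_ideal scale \<Lambda> M C D) (cellular_algebra.nil_ideal scale \<Lambda> M C D))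
       (cellular_algebra.nil_ideal scale \<Lambda> M C D) = {0} \<and>
     (\<forall>\<tau>' D'. unital_algebra.symmetrizing_trace scale \<tau>' \<longrightarrow>
        cellular_algebra.dual_basis scale \<Lambda> M C \<tau>' D' \<longrightarrow>
        cellular_algebra.nil_ideal scale \<Lambda> M C D' = cellular_algebra.nil_ideal scale \<Lambda> M C D) \<and>
     ((\<forall>x::'r. x \<noteq> 0 \<longrightarrow> x dvd 1) \<longrightarrow>
        dim_over scale (cellular_algebra.nil_ideal scale \<Lambda> M C D)
          \<ge> (\<Sum>l \<in> cellular_algebra.\<Lambda>2 scale \<Lambda> M C.
               (card (M l) + cellular_algebra.dim_rad scale \<Lambda> M C l) * cellular_algebra.dim_L scale \<Lambda> M C l)
            + (\<Sum>l \<in> cellular_algebra.\<Lambda>4 scale \<Lambda> M C D. (card (M l))\<^sup>2) \<and>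
        (\<Sum>l \<in> cellular_algebra.\<Lambda>2 scale \<Lambda> M C. (int (cellular_algebra.dim_L scale \<Lambda> M C l))\<^sup>2)
            - (\<Sum>l \<in> cellular_algebra.\<Lambda>3 scale \<Lambda> M C. (int (card (M l)))\<^sup>2)
          \<le> (\<Sum>l \<in> cellular_algebra.\<Lambda>2 scale \<Lambda> M C. (int (cellular_algebra.dim_rad scale \<Lambda> M C l))\<^sup>2)
            - (\<Sum>l \<in> cellular_algebra.\<Lambda>4 scale \<Lambda> M C D. (int (card (M l)))\<^sup>2))"
proof -
  interpret cellular_algebra scale \<Lambda> M C i
    by (rule assms(1))
  have inst: "symmetric_cellular_algebra scale \<Lambda> M C i \<tau>' D'"
    if "symmetrizing_trace \<tau>'" "dual_basis \<tau>' D'" for \<tau>' D'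
    using that by unfold_locales
  interpret symmetric_cellular_algebra scale \<Lambda> M C i \<tau> D
    by (rule inst[OF assms(2,3)])
  have "nil_ideal D' = nil_ideal D" if *: "symmetrizing_trace \<tau>'" "dual_basis \<tau>' D'" for \<tau>' D'
  proof
    show "nil_ideal D' \<subseteq> nil_ideal D"
      by (rule nil_ideal_mono[OF inst[OF *]])
    \<comment> \<open>The same inclusion with the roles of the two traces exchanged.\<close>
    show "nil_ideal D \<subseteq> nil_ideal D'"
      by (rule symmetric_cellular_algebra.nil_ideal_mono[OF inst[OF *] inst[OF assms(2,3)]])
  qed
  then show ?thesis
    using nil_ideal_subset_radical set_prod_nil_ideal dim_nil_ideal_ge dimension_inequality
    by blast
qed

end
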